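(* For every positive integer $i$ and every integer $n\geq 1$, the $i$-generalized Fibonacci snowflake of order $n$ is a double square.
   Context: Alphabet $\mathcal{A}=\{0,1,2,3\}$ with addition mod 4; words are lattice paths with steps $0=(1,0),1=(0,1),2=(-1,0),3=(0,-1)$. For $w=w_1\cdots w_m$ and $\alpha\in\mathcal{A}$, $\Sigma^\circ_\alpha(w)=\alpha(\alpha+w_1)\cdots(\alpha+w_1+\cdots+w_{m-1})$. The morphism $\overline{\cdot}$: $\overline{0}=0,\overline{1}=3,\overline{2}=2,\overline{3}=1$. Words $q^{[i]}_n$: if $i$ is even, $q^{[i]}_0=\varepsilon$, $q^{[i]}_1=1$, $q^{[i]}_2=(13)^{i/2}$, and for $n\ge3$, $q^{[i]}_n=q^{[i]}_{n-1}q^{[i]}_{n-2}$ if $n\equiv1\pmod3$, $q^{[i]}_n=q^{[i]}_{n-1}\overline{q^{[i]}_{n-2}}$ if $n\equiv0,2\pmod3$; if $i$ is odd, $q^{[i]}_0=\varepsilon$, $q^{[i]}_1=1$, $q^{[i]}_2=(13)^{(i-1)/2}1$, and for $n\ge3$, $q^{[i]}_n=q^{[i]}_{n-1}q^{[i]}_{n-2}$ if $n\equiv0\pmod3$, $q^{[i]}_n=q^{[i]}_{n-1}\overline{q^{[i]}_{n-2}}$ if $n\equiv1,2\pmod3$. The $i$-generalized Fibonacci snowflake of order $n$ is the polyomino (finite union of unit lattice squares bounded by a non-crossing closed lattice path) whose boundary word is $\Sigma^\circ_\alpha((q^{[i]}_{3n})^4)$ if $i$ is even, resp. $\Sigma^\circ_\alpha((q^{[i]}_{3n+2})^4)$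 if $i$ is odd, for some $\alpha\in\mathcal{A}$. For a path $w$, $\widehat{w}=\rho^2(w^R)$, where $w^R$ is the reversal and $\rho^2(a)=a+2$ mod 4 letterwise (the path traversed backwards). A BN-square factorization of a polyomino's boundary word is an expression of the boundary word, up to cyclic permutation of its letters, as $A\cdot B\cdot\widehat{A}\cdot\widehat{B}$; a polyomino is a double square if its boundary word admits exactly two distinct such factorizations (factorizations obtained from each other by cyclically permuting the four factors being identified). *)

theory Defs
  imports Main "HOL-Library.Numeral_Type" "HOL-Library.Product_Plus"
begin

text \<open>
  The alphabet \<open>{0,1,2,3}\<close> with addition modulo 4 is the numeral type \<open>4\<close>.
  Letters are unit steps; a word is the lattice path it describes.
\<close>

type_synonym word4 = "4 list"

definition step :: "4 \<Rightarrow> int \<times> int" where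
  "step a = (if a = 0 then (1, 0) else if a = 1 then (0, 1)
             else if a = 2 then (- 1, 0) else (0, - 1))"

definition bar :: "word4 \<Rightarrow> word4" where
  "bar = map (\<lambda>a. if a = 1 then 3 else if a = 3 then 1 else a)"

text \<open>\<open>\<alpha> (\<alpha> + w\<^sub>1) \<dots> (\<alpha> + w\<^sub>1 + \<dots> + w\<^sub>m\<^sub>-\<^sub>1)\<close>: the last letter of \<open>w\<close> is not used.\<close>

definition Sigma_circ :: "4 \<Rightarrow> word4 \<Rightarrow> word4" where
  "Sigma_circ \<alpha> w = map (\<lambda>k. \<alpha> + sum_list (take k w)) [0..<length w]"

fun q :: "nat \<Rightarrow> nat \<Rightarrow> word4" where
  "q i 0 = []"
| "q i (Suc 0) = [1]"
| "q i (Suc (Suc 0)) =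
     (if even i then concat (replicate (i div 2) [1, 3])
      else concat (replicate ((i - 1) div 2) [1, 3]) @ [1])"
| "q i (Suc (Suc (Suc n))) =
     (if Suc (Suc (Suc n)) mod 3 = (if even i then 1 else 0)
      then q i (Suc (Suc n)) @ q i (Suc n)
      else q i (Suc (Suc n)) @ bar (q i (Suc n)))"

definition snowflake_word :: "4 \<Rightarrow> nat \<Rightarrow> nat \<Rightarrow> word4" where
  "snowflake_word \<alpha> i n =
     Sigma_circ \<alpha> (concat (replicate 4 (if even i then q i (3 * n) else q i (3 * n + 2))))"

text \<open>Paths starting at a lattice point \<open>p\<close>; \<open>edge p w k\<close> is the unit segment, without
  orientation, traversed by the letter \<open>w ! k\<close>.\<close>

definition vertex :: "int \<times> int \<Rightarrow> word4 \<Rightarrow> nat \<Rightarrow> int \<times> int" where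
  "vertex p w k = p + sum_list (map step (take k w))"

definition edge :: "int \<times> int \<Rightarrow> word4 \<Rightarrow> nat \<Rightarrow> (int \<times> int) set" where
  "edge p w k = {vertex p w k, vertex p w (Suc k)}"

definition closed_path :: "word4 \<Rightarrow> bool" where
  "closed_path w \<longleftrightarrow> sum_list (map step w) = 0"

text \<open>
  The letter by which a closed path arrives at the vertex that it leaves by \<open>w ! k\<close>.
\<close>

definition incoming :: "word4 \<Rightarrow> nat \<Rightarrow> 4" where
  "incoming w k = w ! ((k + length w - 1) mod length w)"

text \<open>
  A non-crossing closed path may touch itself at vertices: for \<open>i = 1\<close> the snowflakes
  do so, already in order 1, where the enclosed region consists of five squares joined at
  corners.  No edge is traversed twice, so two passages through the same vertex use its
  four incident edges, and they cross (their pairs of edges interleave around the vertex)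
  if and only if both go straight on; otherwise both turn and can be separated by rounding
  the corners.  Neither condition depends
  on the starting point.
\<close>

definition non_crossing :: "word4 \<Rightarrow> bool" where
  "non_crossing w \<longleftrightarrow>
     inj_on (edge 0 w) {..<length w} \<and>
     (\<forall>j k. j < k \<and> k < length w \<and> vertex 0 w j = vertex 0 w k \<longrightarrow>
        \<not> (incoming w j = w ! j \<and> incoming w k = w ! k))"

text \<open>
  A finite union of unit squares is given by the finite set of the lower left corners of
  its squares.  Its boundary consists of the edges between a square of the union and a
  square outside of it.
\<close>

definition sides :: "int \<times> int \<Rightarrow> (int \<times> int) set set" where
  "sides c = {{c, c + (1, 0)}, {c + (1, 0), c + (1, 1)},
              {c + (0, 1), c + (1, 1)}, {c, c + (0, 1)}}"

definition boundary_edges :: "(int \<times> int) set \<Rightarrow> (int \<times> int) set set" where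
  "boundary_edges P = {e. \<exists>c\<in>P. \<exists>d. d \<notin> P \<and> e \<in> sides c \<and> e \<in> sides d}"

text \<open>
  The polyomino made of the squares \<open>P\<close> has the boundary word \<open>w\<close>.  The word is part of the
  data of a polyomino: when the path touches itself, the set \<open>P\<close> alone need not
  determine in which way the boundary passes through the points of contact.
\<close>

definition polyomino :: "(int \<times> int) set \<Rightarrow> word4 \<Rightarrow> bool" where
  "polyomino P w \<longleftrightarrow>
     finite P \<and> P \<noteq> {} \<and> closed_path w \<and> non_crossing w \<and>
     (\<exists>p. boundary_edges P = edge p w ` {..<length w})"

definition snowflake :: "nat \<Rightarrow> nat \<Rightarrow> (int \<times> int) set \<Rightarrow> word4 \<Rightarrow> bool" where
  "snowflake i n P w \<longleftrightarrow> polyomino P w \<and> (\<exists>\<alpha>. w = snowflake_word \<alpha> i n)"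

definition hat :: "word4 \<Rightarrow> word4" where
  "hat w = map (\<lambda>a. a + 2) (rev w)"

definition BN_square_factorizations :: "word4 \<Rightarrow> word4 list set" where
  "BN_square_factorizations w =
     {[A, B, hat A, hat B] | A B. \<exists>k. rotate k w = A @ B @ hat A @ hat B}"

definition cyclic_shift :: "('a list \<times> 'a list) set" where
  "cyclic_shift = {(F, G). \<exists>k. G = rotate k F}"

definition double_square :: "(int \<times> int) set \<Rightarrow> word4 \<Rightarrow> bool" where
  "double_square P w \<longleftrightarrow>
     polyomino P w \<and> card (BN_square_factorizations w // cyclic_shift) = 2"

end

theory Submission
  imports Defs Complex_Main
begin

text \<open>
  All turns of a snowflake path are left or right turns. Its turn word is \<open>Q\<^sup>4\<close> with
  \<open>Q = u \<cdot> bar v\<close>, where the pair \<open>(u, v)\<close> arises by iterating the substitution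
  \<open>(u, v) \<mapsto> (u \<cdot> bar v \<cdot> u \<cdot> bar u \<cdot> v, u \<cdot> bar v \<cdot> u)\<close>, starting from a zigzag \<open>(13)\<^sup>j\<close> and the single
  letter \<open>1\<close>; the two parities of \<open>i\<close> differ only in which of \<open>u\<close>, \<open>v\<close> is the zigzag.

  No edge is used twice: in suitable coordinates (rotated by 45 degrees if \<open>i\<close> is even) the
  path of \<open>u\<close> stays in a rectangle \<open>a \<times> b\<close> with the chord of the path as a side, and that of
  \<open>v\<close> stays in a square \<open>b \<times> b\<close> with the chord as a diagonal. The substitution dissects the
  rectangle \<open>(a + 2 b) \<times> (a + b)\<close> and the square of side \<open>a + b\<close> into such pieces, with a hole
  left over, so that by induction different pieces of the path cannot meet in an edge.

  The two factors \<open>A\<close>, \<open>B\<close> of a factorization are palindromes of the same length \<open>|Q|\<close>, since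
  a longer one would contain two opposite turns at distance \<open>|Q|\<close>. Factorizations therefore
  correspond to the positions \<open>j\<close> modulo \<open>|Q|\<close> such that the reflection in \<open>j\<close> reverses all
  turns of the periodic turn word except the one at \<open>j\<close>. Multiplying with a primitive
  character \<open>\<chi>\<close> and summing over a period yields one quadratic equation satisfied by \<open>\<chi> j\<close> for
  all such \<open>j\<close>, so there are at most two of them; the ends of \<open>u\<close> and of \<open>bar v\<close> are two.
\<close>

section \<open>Dissections of boxes\<close>

definition rot :: "int \<times> int \<Rightarrow> int \<times> int" where "rot = (\<lambda>(x, y). (- y, x))"
definition rotr :: "int \<times> int \<Rightarrow> int \<times> int" where "rotr = (\<lambda>(x, y). (y, - x))"
definition mirror :: "int \<times> int \<Rightarrow> int \<times> int" where "mirror = (\<lambda>(x, y). (x, - y))"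
definition swap_xy :: "int \<times> int \<Rightarrow> int \<times> int" where "swap_xy = (\<lambda>(x, y). (y, x))"
definition neg_swap_xy :: "int \<times> int \<Rightarrow> int \<times> int" where "neg_swap_xy = (\<lambda>(x, y). (- y, - x))"

lemmas sym_defs = rot_def rotr_def mirror_def swap_xy_def neg_swap_xy_def

text \<open>The first component is a doubled midpoint, so moving a path by \<open>c\<close> moves it
  by \<open>c + c\<close>.\<close>

definition place :: "int \<times> int \<Rightarrow> (int \<times> int \<Rightarrow> int \<times> int) \<Rightarrow>
    (int \<times> int) \<times> (int \<times> int) \<Rightarrow> (int \<times> int) \<times> (int \<times> int)" where
  "place c F = (\<lambda>(m, s). (c + c + F m, F s))"

text \<open>A traversed edge is recorded by twice its midpoint and its direction. On each side of its
  box a path may use edges of one direction only. Where two boxes touch, these directions are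
  opposite to each other, which keeps the oriented edges of the boxes apart. The same edge is
  not used in both directions because horizontal steps start at vertices of one parity only.\<close>

definition regU :: "int \<Rightarrow> int \<Rightarrow> ((int \<times> int) \<times> (int \<times> int)) set" where
  "regU a b = {((x, y), (s, t)). 0 \<le> x \<and> x \<le> 2 * a \<and> - 2 * b \<le> y \<and> y \<le> 0
     \<and> (y = 0 \<or> y = - 2 * b \<longrightarrow> s = 1 \<and> t = 0)
     \<and> (x = 0 \<longrightarrow> s = 0 \<and> t = -1) \<and> (x = 2 * a \<longrightarrow> s = 0 \<and> t = 1)}"

definition regV :: "int \<Rightarrow> ((int \<times> int) \<times> (int \<times> int)) set" where
  "regV b = {((x, y), (s, t)). 0 \<le> x \<and> x \<le> 2 * b \<and> 0 \<le> y \<and> y \<le> 2 * b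
     \<and> (x = 0 \<or> x = 2 * b \<longrightarrow> s = 0 \<and> t = 1)
     \<and> (y = 0 \<or> y = 2 * b \<longrightarrow> s = 1 \<and> t = 0)}"

lemma disjoint_imageI:
  assumes "\<And>x y s t x' y' s' t'. ((x, y), (s, t)) \<in> A \<Longrightarrow> ((x', y'), (s', t')) \<in> B \<Longrightarrow>
     f ((x, y), (s, t)) \<noteq> g ((x', y'), (s', t'))"
  shows "f ` A \<inter> g ` B = {}"
  using assms by fastforce

text \<open>In undoubled coordinates the boxes run down the left side of the large rectangle, along
  its bottom and up its right side: \<open>[0,b] x [-a,0]\<close>, \<open>[0,b] x [-a-b,-a]\<close>,
  \<open>[b,a+b] x [-a-b,-a]\<close>, \<open>[a+b,a+2b] x [-a-b,-b]\<close>,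
  \<open>[a+b,a+2b] x [-b,0]\<close>. The square \<open>[b,a+b] x [-a,0]\<close> is left
  over.\<close>

lemma regU_subdivision_subset:
  assumes "a \<ge> 1" "b \<ge> 0"
  shows "place 0 neg_swap_xy ` regU a b \<subseteq> regU (a + 2 * b) (a + b)"
    and "place (0, - a) rotr ` regV b \<subseteq> regU (a + 2 * b) (a + b)"
    and "place (b, - a - b) mirror ` regU a b \<subseteq> regU (a + 2 * b) (a + b)"
    and "place (a + b, - a - b) rot ` regU a b \<subseteq> regU (a + 2 * b) (a + b)"
    and "place (a + b, - b) swap_xy ` regV b \<subseteq> regU (a + 2 * b) (a + b)"
  using assms unfolding place_def sym_defs regU_def regV_def zero_prod_def
  by (clarsimp; smt (verit))+

lemma regU_subdivision_disjoint:
  assumes "a \<ge> 1" "b \<ge> 0"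
  shows "place 0 neg_swap_xy ` regU a b \<inter> place (0, - a) rotr ` regV b = {}"
    and "place 0 neg_swap_xy ` regU a b \<inter> place (b, - a - b) mirror ` regU a b = {}"
    and "place 0 neg_swap_xy ` regU a b \<inter> place (a + b, - a - b) rot ` regU a b = {}"
    and "place 0 neg_swap_xy ` regU a b \<inter> place (a + b, - b) swap_xy ` regV b = {}"
    and "place (0, - a) rotr ` regV b \<inter> place (b, - a - b) mirror ` regU a b = {}"
    and "place (0, - a) rotr ` regV b \<inter> place (a + b, - a - b) rot ` regU a b = {}"
    and "place (0, - a) rotr ` regV b \<inter> place (a + b, - b) swap_xy ` regV b = {}"
    and "place (b, - a - b) mirror ` regU a b \<inter> place (a + b, - a - b) rot ` regU a b = {}"
    and "place (b, - a - b) mirror ` regU a b \<inter> place (a + b, - b) swap_xy ` regV b = {}"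
    and "place (a + b, - a - b) rot ` regU a b \<inter> place (a + b, - b) swap_xy ` regV b = {}"
  unfolding place_def sym_defs regU_def regV_def zero_prod_def
  by (rule disjoint_imageI, insert assms, (clarsimp; smt (verit)))+

text \<open>The boxes are \<open>[0,a] x [0,b]\<close>, \<open>[a,a+b] x [0,b]\<close> and
  \<open>[a,a+b] x [b,a+b]\<close>. The upper left square of side \<open>a\<close> is left
  over.\<close>

lemma regV_subdivision_subset:
  assumes "a \<ge> 1" "b \<ge> 0"
  shows "place 0 mirror ` regU a b \<subseteq> regV (a + b)"
    and "place (a, 0) id ` regV b \<subseteq> regV (a + b)"
    and "place (a + b, b) swap_xy ` regU a b \<subseteq> regV (a + b)"
  using assms unfolding place_def sym_defs regU_def regV_def zero_prod_def
  by (clarsimp; smt (verit))+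

lemma regV_subdivision_disjoint:
  assumes "a \<ge> 1" "b \<ge> 0"
  shows "place 0 mirror ` regU a b \<inter> place (a, 0) id ` regV b = {}"
    and "place 0 mirror ` regU a b \<inter> place (a + b, b) swap_xy ` regU a b = {}"
    and "place (a, 0) id ` regV b \<inter> place (a + b, b) swap_xy ` regU a b = {}"
  unfolding place_def sym_defs regU_def regV_def zero_prod_def
  by (rule disjoint_imageI, insert assms, (clarsimp; smt (verit)))+

section \<open>Paths in boxes\<close>

lemma four_cases: "(a::4) = 0 \<or> a = 1 \<or> a = 2 \<or> a = 3"
proof (cases a)
  case (of_int z)
  then have "z = 0 \<or> z = 1 \<or> z = 2 \<or> z = 3" by auto
  with of_int show ?thesis by auto
qed

fun trace :: "int \<times> int \<Rightarrow> (int \<times> int) list \<Rightarrow> ((int \<times> int) \<times> (int \<times> int)) list" where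
  "trace z [] = []"
| "trace z (s # ss) = (z + z + s, s) # trace (z + s) ss"

lemma trace_append: "trace z (xs @ ys) = trace z xs @ trace (z + sum_list xs) ys"
  by (induction xs arbitrary: z) (simp_all add: add.assoc)

lemma trace_map:
  assumes "additive F"
  shows "trace (c + F z) (map F xs) = map (place c F) (trace z xs)"
proof (induction xs arbitrary: z)
  case (Cons x xs)
  interpret additive F by (rule assms)
  show ?case using Cons[of "z + x"] by (simp add: place_def add algebra_simps)
qed simp

lemma trace_map_0: "additive F \<Longrightarrow> trace c (map F xs) = map (place c F) (trace 0 xs)"
  using trace_map[of F c 0 xs] by (simp add: additive.zero)

lemma additive_syms [simp]:
  "additive rot" "additive rotr" "additive mirror" "additive swap_xy" "additive neg_swap_xy" "additive id"
  by unfold_locales (auto simp: sym_defs)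

lemma additive_comp: "additive F \<Longrightarrow> additive G \<Longrightarrow> additive (F \<circ> G)"
  by (simp add: additive_def)

lemma inj_syms [simp]: "inj rot" "inj rotr" "inj mirror" "inj swap_xy" "inj neg_swap_xy"
  by (auto intro!: injI simp: sym_defs split: prod.splits)

lemma sum_list_map_additive: "additive F \<Longrightarrow> sum_list (map F xs) = F (sum_list xs)"
  by (induction xs) (simp_all add: additive.zero additive.add)

lemma inj_place: "inj F \<Longrightarrow> inj_on (place c F) A"
  by (auto simp: inj_on_def place_def)

definition boxed :: "int \<Rightarrow> int \<Rightarrow> (int \<times> int) list \<Rightarrow> (int \<times> int) list \<Rightarrow> bool" where
  "boxed a b U V \<longleftrightarrow>
     distinct (trace 0 U) \<and> set (trace 0 U) \<subseteq> regU a b \<and> sum_list U = (a, 0) \<and>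
     distinct (trace 0 V) \<and> set (trace 0 V) \<subseteq> regV b \<and> sum_list V = (b, b)"

lemma distinct_trace_map:
  "additive F \<Longrightarrow> inj F \<Longrightarrow> distinct (trace 0 xs) \<Longrightarrow> distinct (trace c (map F xs))"
  by (simp add: trace_map_0 distinct_map inj_place)

lemma set_trace_map:
  "additive F \<Longrightarrow> set (trace 0 xs) \<subseteq> R \<Longrightarrow> set (trace c (map F xs)) \<subseteq> place c F ` R"
  by (auto simp: trace_map_0)

lemma distinct_concat_regions:
  assumes "\<forall>(xs, A) \<in> set ps. distinct xs \<and> set xs \<subseteq> A"
    and "sorted_wrt (\<lambda>(_, A) (_, B). A \<inter> B = {}) ps"
  shows "distinct (concat (map fst ps))"
  using assms
proof (induction ps)
  case (Cons p ps)
  then have "fst p \<noteq> [] \<Longrightarrow> set (fst p) \<inter> set (concat (map fst ps)) = {}"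
    by (fastforce split: prod.splits)
  with Cons show ?case by (cases "fst p = []") (auto split: prod.splits)
qed simp

text \<open>The transformed pieces are laid end to end. The partial sums of their chords are exactly
  the offsets used in the dissections, so each piece falls into its own box.\<close>

lemma boxed_subdivide:
  assumes "boxed a b U V" "a \<ge> 1" "b \<ge> 0"
  shows "boxed (a + 2 * b) (a + b)
           (map neg_swap_xy U @ map rotr V @ map mirror U @ map rot U @ map swap_xy V)
           (map mirror U @ V @ map swap_xy U)"
proof -
  have U: "distinct (trace 0 U)" "set (trace 0 U) \<subseteq> regU a b" "sum_list U = (a, 0)"
    and V: "distinct (trace 0 V)" "set (trace 0 V) \<subseteq> regV b" "sum_list V = (b, b)"
    using assms(1) by (auto simp: boxed_def)
  have sums: "sum_list (map neg_swap_xy U) = (0, - a)" "sum_list (map rotr V) = (b, - b)"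
    "sum_list (map mirror U) = (a, 0)" "sum_list (map rot U) = (0, a)"
    "sum_list (map swap_xy V) = (b, b)" "sum_list (map swap_xy U) = (0, a)"
    by (simp_all only: sum_list_map_additive additive_syms U V) (simp_all add: sym_defs)
  have U': "trace 0 (map neg_swap_xy U @ map rotr V @ map mirror U @ map rot U @ map swap_xy V) =
     trace 0 (map neg_swap_xy U) @ trace (0, - a) (map rotr V) @ trace (b, - a - b) (map mirror U) @
     trace (a + b, - a - b) (map rot U) @ trace (a + b, - b) (map swap_xy V)"
    by (simp add: trace_append sums algebra_simps)
  \<comment> \<open>\<open>id\<close> gives the middle piece the form \<open>map F\<close>, so that
    it is treated like the transformed ones.\<close>
  have "trace (a, 0) V = trace (a, 0) (map id V)" by simp
  then have V': "trace 0 (map mirror U @ V @ map swap_xy U) =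
     trace 0 (map mirror U) @ trace (a, 0) (map id V) @ trace (a + b, b) (map swap_xy U)"
    by (simp add: trace_append sums V algebra_simps)
  note d = distinct_trace_map[OF _ _ U(1)] distinct_trace_map[OF _ _ V(1)]
  note s = set_trace_map[OF _ U(2)] set_trace_map[OF _ V(2)]
  have dU: "distinct (trace 0 (map neg_swap_xy U @ map rotr V @ map mirror U @ map rot U @ map swap_xy V))"
    unfolding U'
    using distinct_concat_regions[of
        "[(trace 0 (map neg_swap_xy U), place 0 neg_swap_xy ` regU a b),
          (trace (0, - a) (map rotr V), place (0, - a) rotr ` regV b),
          (trace (b, - a - b) (map mirror U), place (b, - a - b) mirror ` regU a b),
          (trace (a + b, - a - b) (map rot U), place (a + b, - a - b) rot ` regU a b),
          (trace (a + b, - b) (map swap_xy V), place (a + b, - b) swap_xy ` regV b)]"]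
    by (simp add: d s regU_subdivision_disjoint[OF assms(2,3)])
  have sU: "set (trace 0 (map neg_swap_xy U @ map rotr V @ map mirror U @ map rot U @ map swap_xy V))
      \<subseteq> regU (a + 2 * b) (a + b)"
    unfolding U' set_append Un_subset_iff
    by (intro conjI subset_trans[OF _ regU_subdivision_subset(1)[OF assms(2,3)]]
        subset_trans[OF _ regU_subdivision_subset(2)[OF assms(2,3)]]
        subset_trans[OF _ regU_subdivision_subset(3)[OF assms(2,3)]]
        subset_trans[OF _ regU_subdivision_subset(4)[OF assms(2,3)]]
        subset_trans[OF _ regU_subdivision_subset(5)[OF assms(2,3)]] s) simp_all
  have dV: "distinct (trace 0 (map mirror U @ V @ map swap_xy U))"
    unfolding V'
    using distinct_concat_regions[of
        "[(trace 0 (map mirror U), place 0 mirror ` regU a b),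
          (trace (a, 0) (map id V), place (a, 0) id ` regV b),
          (trace (a + b, b) (map swap_xy U), place (a + b, b) swap_xy ` regU a b)]"]
    by (simp add: d s regV_subdivision_disjoint[OF assms(2,3)] del: list.map_id0 map_idI)
  have sV: "set (trace 0 (map mirror U @ V @ map swap_xy U)) \<subseteq> regV (a + b)"
    unfolding V' set_append Un_subset_iff
    by (intro conjI subset_trans[OF _ regV_subdivision_subset(1)[OF assms(2,3)]]
        subset_trans[OF _ regV_subdivision_subset(2)[OF assms(2,3)]]
        subset_trans[OF _ regV_subdivision_subset(3)[OF assms(2,3)]] s) simp_all
  show ?thesis
    unfolding boxed_def using dU sU dV sV by (simp add: sums V)
qed

section \<open>The box of a quarter and the ring of four quarters\<close>

definition regT :: "int \<Rightarrow> int \<Rightarrow> ((int \<times> int) \<times> (int \<times> int)) set" where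
  "regT a b = {((x, y), (s, t)). 0 \<le> x \<and> x \<le> 2 * (a + b) \<and> - 2 * b \<le> y \<and> y \<le> 0
     \<and> (y = 0 \<or> y = - 2 * b \<longrightarrow> s = 1 \<and> t = 0)
     \<and> (x = 0 \<or> x = 2 * (a + b) \<longrightarrow> s = 0 \<and> t = -1)}"

lemma regT_parts:
  assumes "a \<ge> 1" "b \<ge> 0"
  shows "regU a b \<subseteq> regT a b" "place (a, 0) mirror ` regV b \<subseteq> regT a b"
  using assms unfolding place_def sym_defs regU_def regV_def regT_def zero_prod_def
  by (clarsimp; smt (verit))+

lemma regU_regV_disjoint:
  assumes "a \<ge> 1" "b \<ge> 0"
  shows "place 0 id ` regU a b \<inter> place (a, 0) mirror ` regV b = {}"
  unfolding place_def sym_defs regU_def regV_def zero_prod_def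
  by (rule disjoint_imageI, insert assms, (clarsimp; smt (verit)))

text \<open>Four boxes of size \<open>(a + b) x b\<close>, each turned by a right angle against the
  previous one, form a pinwheel around the square \<open>[0,a] x [-a-b,-b]\<close>.\<close>

lemma ring_disjoint:
  assumes "a \<ge> 1" "b \<ge> 0"
  shows "place 0 id ` regT a b \<inter> place (a + b, - b) rotr ` regT a b = {}"
    and "place 0 id ` regT a b \<inter> place (a, - a - 2 * b) uminus ` regT a b = {}"
    and "place 0 id ` regT a b \<inter> place (- b, - a - b) rot ` regT a b = {}"
    and "place (a + b, - b) rotr ` regT a b \<inter> place (a, - a - 2 * b) uminus ` regT a b = {}"
    and "place (a + b, - b) rotr ` regT a b \<inter> place (- b, - a - b) rot ` regT a b = {}"
    and "place (a, - a - 2 * b) uminus ` regT a b \<inter> place (- b, - a - b) rot ` regT a b = {}"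
  unfolding place_def sym_defs regT_def zero_prod_def
  by (rule disjoint_imageI, insert assms, (clarsimp; smt (verit)))+

lemma boxed_ring:
  assumes "boxed a b U V" "a \<ge> 1" "b \<ge> 0"
  defines "T \<equiv> U @ map mirror V"
  shows "distinct (trace 0 (T @ map rotr T @ map uminus T @ map rot T))"
    and "sum_list (T @ map rotr T @ map uminus T @ map rot T) = 0"
proof -
  have U: "distinct (trace 0 U)" "set (trace 0 U) \<subseteq> regU a b" "sum_list U = (a, 0)"
    and V: "distinct (trace 0 V)" "set (trace 0 V) \<subseteq> regV b" "sum_list V = (b, b)"
    using assms(1) by (auto simp: boxed_def)
  have um: "additive (uminus :: int \<times> int \<Rightarrow> _)" "inj (uminus :: int \<times> int \<Rightarrow> _)"
    by unfold_locales (simp_all add: inj_def)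
  note d = distinct_trace_map[OF _ _ U(1)] distinct_trace_map[OF _ _ V(1)]
  note s = set_trace_map[OF _ U(2)] set_trace_map[OF _ V(2)]
  have "map id U = U" by simp
  then have tr: "trace 0 T = trace 0 (map id U) @ trace (a, 0) (map mirror V)"
    by (simp add: T_def trace_append U)
  have dT: "distinct (trace 0 T)"
    unfolding tr
    using distinct_concat_regions[of
        "[(trace 0 (map id U), place 0 id ` regU a b),
          (trace (a, 0) (map mirror V), place (a, 0) mirror ` regV b)]"]
    by (simp add: d s regU_regV_disjoint[OF assms(2,3)] del: list.map_id0 map_idI)
  have sT: "set (trace 0 T) \<subseteq> regT a b"
    using tr U(2) set_trace_map[OF _ V(2), of mirror "(a, 0)"] regT_parts[OF assms(2,3)]
    by auto
  have sumT: "sum_list T = (a + b, - b)"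
    by (simp only: T_def sum_list_append U V sum_list_map_additive additive_syms) (simp add: sym_defs)
  have sums: "sum_list (map rotr T) = (- b, - a - b)" "sum_list (map uminus T) = (- a - b, b)"
      "sum_list (map rot T) = (b, a + b)"
    by (simp_all only: sum_list_map_additive additive_syms um sumT) (simp_all add: sym_defs)
  show "sum_list (T @ map rotr T @ map uminus T @ map rot T) = 0"
    by (simp add: sums sumT zero_prod_def)
  have "trace 0 (T @ map rotr T @ map uminus T @ map rot T) =
     trace 0 (map id T) @ trace (a + b, - b) (map rotr T) @
     trace (a, - a - 2 * b) (map uminus T) @ trace (- b, - a - b) (map rot T)"
    by (simp add: trace_append sums sumT algebra_simps)
  moreover have "distinct \<dots>"
    using distinct_concat_regions[of
        "[(trace 0 (map id T), place 0 id ` regT a b),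
          (trace (a + b, - b) (map rotr T), place (a + b, - b) rotr ` regT a b),
          (trace (a, - a - 2 * b) (map uminus T), place (a, - a - 2 * b) uminus ` regT a b),
          (trace (- b, - a - b) (map rot T), place (- b, - a - b) rot ` regT a b)]"]
    by (simp add: um distinct_trace_map[OF _ _ dT] set_trace_map[OF _ sT]
        ring_disjoint[OF assms(2,3)] del: list.map_id0 map_idI)
  ultimately show "distinct (trace 0 (T @ map rotr T @ map uminus T @ map rot T))" by simp
qed

section \<open>Turn words\<close>

definition rot4 :: "4 \<Rightarrow> int \<times> int \<Rightarrow> int \<times> int" where
  "rot4 c = (if c = 0 then id else if c = 1 then rot else if c = 2 then uminus else rotr)"

lemma step_add: "step (c + a) = rot4 c (step a)"
  using four_cases[of c] four_cases[of a] by (auto simp: step_def rot4_def rot_def rotr_def)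

lemma rot4_add: "rot4 (c + d) z = rot4 c (rot4 d z)"
  using four_cases[of c] four_cases[of d]
  by (elim disjE) (simp_all add: rot4_def rot_def rotr_def split: prod.splits)

lemma step_uminus: "step (- a) = mirror (step a)"
  using four_cases[of a] by (auto simp: step_def mirror_def)

lemma additive_rot4: "additive (rot4 c)"
  by unfold_locales (auto simp: rot4_def rot_def rotr_def split: prod.splits)

lemma inj_rot4: "inj (rot4 c)"
  by (auto simp: rot4_def inj_def)  (auto simp: rot_def rotr_def)

lemma bar_eq: "bar = map uminus"
proof -
  have "(if a = 1 then 3 else if a = 3 then 1 else a) = - a" for a :: 4
    using four_cases[of a] by auto
  then show ?thesis unfolding bar_def by presburger
qed

lemma bar_bar [simp]: "bar (bar w) = w"
  by (simp add: bar_eq comp_def)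

lemma sum_list_bar [simp]: "sum_list (bar w) = - sum_list w"
  unfolding bar_eq by (induction w) simp_all

lemma bar_append [simp]: "bar (u @ v) = bar u @ bar v"
  by (simp add: bar_eq)

lemma bar_Nil [simp]: "bar [] = []"
  by (simp add: bar_eq)

lemma bar_Cons [simp]: "bar (a # w) = - a # bar w"
  by (simp add: bar_eq)

lemma length_bar [simp]: "length (bar w) = length w"
  by (simp add: bar_eq)

lemma Sigma_circ_append:
  "Sigma_circ \<alpha> (u @ v) = Sigma_circ \<alpha> u @ Sigma_circ (\<alpha> + sum_list u) v"
  by (rule nth_equalityI) (auto simp: Sigma_circ_def nth_append add.assoc)

lemma Sigma_circ_Nil [simp]: "Sigma_circ \<alpha> [] = []"
  by (simp add: Sigma_circ_def)

lemma Sigma_circ_Cons: "Sigma_circ \<alpha> (a # v) = \<alpha> # Sigma_circ (\<alpha> + a) v"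
  using Sigma_circ_append[of \<alpha> "[a]" v] by (simp add: Sigma_circ_def)

lemma Sigma_circ_shift: "Sigma_circ (\<beta> + \<alpha>) w = map ((+) \<beta>) (Sigma_circ \<alpha> w)"
  by (simp add: Sigma_circ_def comp_def add.assoc)

lemma Sigma_circ_bar: "Sigma_circ (- \<alpha>) (bar w) = bar (Sigma_circ \<alpha> w)"
proof (induction w arbitrary: \<alpha>)
  case (Cons a w)
  show ?case using Cons[of "\<alpha> + a"] by (simp add: bar_eq Sigma_circ_Cons)
qed (simp add: bar_eq)

definition steps :: "word4 \<Rightarrow> (int \<times> int) list" where
  "steps w = map step (Sigma_circ 0 w)"

lemma steps_append: "steps (u @ v) = steps u @ map (rot4 (sum_list u)) (steps v)"
  using Sigma_circ_shift[of "sum_list u" 0 v]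
  by (simp add: steps_def Sigma_circ_append step_add comp_def)

lemma steps_bar: "steps (bar w) = map mirror (steps w)"
  using Sigma_circ_bar[of 0 w] by (simp add: steps_def bar_eq step_uminus comp_def)

lemma step_Sigma_circ: "map step (Sigma_circ \<alpha> w) = map (rot4 \<alpha>) (steps w)"
  using Sigma_circ_shift[of \<alpha> 0 w] by (simp add: steps_def step_add comp_def)

text \<open>One application amounts to three steps of the recursion for \<open>q\<close>: with
  \<open>u\<close> and \<open>v\<close> two consecutive words, the next ones are
  \<open>u @ bar v\<close>, then that word followed by \<open>u\<close>, then the latter followed by
  \<open>bar u @ v\<close>.\<close>

definition refine :: "word4 \<times> word4 \<Rightarrow> word4 \<times> word4" where
  "refine = (\<lambda>(u, v). (u @ bar v @ u @ bar u @ v, u @ bar v @ u))"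

text \<open>\<open>G\<close> maps the directions of the lattice path, started in direction 0, to the coordinates
  in which the boxes are parallel to the axes.\<close>

definition framed :: "(int \<times> int \<Rightarrow> int \<times> int) \<Rightarrow> word4 \<Rightarrow> word4 \<Rightarrow> bool" where
  "framed G u v \<longleftrightarrow> additive G \<and> inj G \<and>
     (\<forall>z. G (rot4 (sum_list u) (mirror z)) = neg_swap_xy (G z)) \<and>
     (\<forall>z. G (rot4 (sum_list u - sum_list v) z) = rotr (G z))"

text \<open>In the coordinates \<open>G\<close> the chord of \<open>v\<close> is
  \<open>(b, -b)\<close>. The additional \<open>rot\<close> turns it into the diagonal
  \<open>(b, b)\<close> of \<open>regV\<close>.\<close>

definition drawn :: "int \<Rightarrow> int \<Rightarrow> (int \<times> int \<Rightarrow> int \<times> int) \<Rightarrow> word4 \<Rightarrow> word4 \<Rightarrow> bool" where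
  "drawn a b G u v \<longleftrightarrow> framed G u v \<and> boxed a b (map G (steps u)) (map (rot \<circ> G) (steps v))"

text \<open>Let \<open>\<sigma>\<close>, \<open>\<tau>\<close> be the total turns of
  \<open>u\<close> and \<open>v\<close>. Refinement keeps \<open>\<sigma>\<close> and replaces
  \<open>\<tau>\<close> by \<open>2 * \<sigma> - \<tau>\<close>, so \<open>\<sigma> - \<tau>\<close>
  changes its sign and the quarter turn is inverted. Composing \<open>G\<close> with a reflection
  inverts it once more, which restores the invariant. The displayed lists are those of
  \<open>boxed_subdivide\<close>.\<close>

lemma framed_refine:
  assumes "framed G u v" and r: "refine (u, v) = (u', v')"
  shows "framed (neg_swap_xy \<circ> G) u' v'"
    and "map (neg_swap_xy \<circ> G) (steps u') = map (neg_swap_xy \<circ> G) (steps u) @ map (rotr \<circ> rot \<circ> G) (steps v) @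
      map (mirror \<circ> G) (steps u) @ map (rot \<circ> G) (steps u) @ map (swap_xy \<circ> rot \<circ> G) (steps v)"
    and "map (rot \<circ> (neg_swap_xy \<circ> G)) (steps v') =
      map (mirror \<circ> G) (steps u) @ map (rot \<circ> G) (steps v) @ map (swap_xy \<circ> G) (steps u)"
proof -
  define \<sigma> \<tau> where "\<sigma> = sum_list u" and "\<tau> = sum_list v"
  have G: "additive G" "inj G" and 1: "\<And>z. G (rot4 \<sigma> (mirror z)) = neg_swap_xy (G z)"
    and 2: "\<And>z. G (rot4 (\<sigma> - \<tau>) z) = rotr (G z)"
    using assms(1) by (auto simp: framed_def \<sigma>_def \<tau>_def)
  have u': "u' = u @ bar v @ u @ bar u @ v" and v': "v' = u @ bar v @ u"
    using r by (auto simp: refine_def)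
  have 3: "G (rot4 (\<tau> - \<sigma>) z) = rot (G z)" for z
  proof -
    have "rotr (G (rot4 (\<tau> - \<sigma>) z)) = G z"
      by (simp add: 2[symmetric] rot4_add[symmetric]) (simp add: rot4_def)
    then show ?thesis by (cases "G (rot4 (\<tau> - \<sigma>) z)"; cases "G z") (auto simp: rot_def rotr_def)
  qed
  have s: "sum_list u' = \<sigma>" "sum_list v' = 2 * \<sigma> - \<tau>"
    by (simp_all add: u' v' \<sigma>_def \<tau>_def)
  have "\<sigma> - (2 * \<sigma> - \<tau>) = \<tau> - \<sigma>" by (simp add: algebra_simps)
  then show "framed (neg_swap_xy \<circ> G) u' v'"
    using G unfolding framed_def s
    by (simp add: additive_comp inj_compose 1 3) (simp add: sym_defs split: prod.splits)
  have e: "G (rot4 (2 * \<sigma> - \<tau>) (mirror z)) = rotr (neg_swap_xy (G z))" for z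
    using 2[of "rot4 \<sigma> (mirror z)"] by (simp add: rot4_add[symmetric] 1 algebra_simps)
  have steps_v': "steps v' = steps u @ map (\<lambda>z. rot4 \<sigma> (mirror z)) (steps v) @ map (rot4 (\<sigma> - \<tau>)) (steps u)"
    by (simp add: v' \<sigma>_def \<tau>_def steps_append steps_bar rot4_add[symmetric])
  have steps_u': "steps u' = steps v' @ map (\<lambda>z. rot4 (2 * \<sigma> - \<tau>) (mirror z)) (steps u) @
      map (rot4 (\<sigma> - \<tau>)) (steps v)"
  proof -
    have "u' = v' @ bar u @ v" by (simp add: u' v')
    moreover have "sum_list v' = 2 * \<sigma> - \<tau>" by (fact s)
    ultimately show ?thesis
      by (simp add: steps_append steps_bar rot4_add[symmetric] \<sigma>_def[symmetric])
  qed
  have c: "neg_swap_xy (rotr z) = mirror z" "neg_swap_xy (neg_swap_xy z) = rotr (rot z)" "neg_swap_xy (rotr (neg_swap_xy z)) = rot z"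
     "neg_swap_xy (rotr (rot z)) = neg_swap_xy z" "swap_xy (rot z) = mirror z" "rot (neg_swap_xy z) = mirror z" "rot (mirror z) = swap_xy z"
     "rotr (rot z) = z" "mirror (neg_swap_xy z) = rot z" for z
    by (cases z; simp add: sym_defs)+
  show "map (neg_swap_xy \<circ> G) (steps u') = map (neg_swap_xy \<circ> G) (steps u) @ map (rotr \<circ> rot \<circ> G) (steps v) @
      map (mirror \<circ> G) (steps u) @ map (rot \<circ> G) (steps u) @ map (swap_xy \<circ> rot \<circ> G) (steps v)"
    by (simp add: steps_u' steps_v' 1 2 e c)
  show "map (rot \<circ> (neg_swap_xy \<circ> G)) (steps v') =
      map (mirror \<circ> G) (steps u) @ map (rot \<circ> G) (steps v) @ map (swap_xy \<circ> G) (steps u)"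
    by (simp add: steps_v' 1 2 c)
qed

lemma drawn_refine:
  assumes "drawn a b G u v" "a \<ge> 1" "b \<ge> 0" "refine (u, v) = (u', v')"
  shows "drawn (a + 2 * b) (a + b) (neg_swap_xy \<circ> G) u' v'"
proof -
  have f: "framed G u v" and b: "boxed a b (map G (steps u)) (map (rot \<circ> G) (steps v))"
    using assms(1) by (auto simp: drawn_def)
  show ?thesis
    unfolding drawn_def framed_refine(2,3)[OF f assms(4)]
    using framed_refine(1)[OF f assms(4)] boxed_subdivide[OF b assms(2,3)]
    by (simp add: comp_assoc)
qed

lemma concat_replicate_4: "concat (replicate 4 w) = w @ w @ w @ w"
  by (simp add: numeral_eq_Suc)

text \<open>The total turn of \<open>u @ bar v\<close> is \<open>\<sigma> - \<tau>\<close>, which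
  acts as \<open>rotr\<close> in the coordinates \<open>G\<close>. The four quarters thus form the
  ring of \<open>boxed_ring\<close>, and injectivity of \<open>G\<close> carries the result
  back.\<close>

lemma drawn_closed:
  assumes "drawn a b G u v" "a \<ge> 1" "b \<ge> 0"
  defines "w \<equiv> concat (replicate 4 (u @ bar v))"
  shows "distinct (trace 0 (steps w))" and "sum_list (steps w) = 0"
proof -
  define \<sigma> \<tau> where "\<sigma> = sum_list u" and "\<tau> = sum_list v"
  have b: "boxed a b (map G (steps u)) (map (rot \<circ> G) (steps v))" and G: "additive G" "inj G"
    and 1: "\<And>z. G (rot4 \<sigma> (mirror z)) = neg_swap_xy (G z)" and 2: "\<And>z. G (rot4 (\<sigma> - \<tau>) z) = rotr (G z)"
    using assms(1) by (auto simp: drawn_def framed_def \<sigma>_def \<tau>_def)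
  define T where "T = map G (steps u) @ map mirror (map (rot \<circ> G) (steps v))"
  have c: "neg_swap_xy z = mirror (rot z)" "rotr (rotr z) = - z" "rotr (- z) = rot z" for z
    by (cases z; simp add: sym_defs)+
  have T: "map G (steps (u @ bar v)) = T"
    by (simp add: T_def steps_append steps_bar \<sigma>_def[symmetric] 1 c(1))
  have app: "map G (steps ((u @ bar v) @ x)) = T @ map rotr (map G (steps x))" for x
    unfolding steps_append[of "u @ bar v"] map_append T
    by (simp add: \<sigma>_def[symmetric] \<tau>_def[symmetric] 2)
  have "map G (steps w) = T @ map rotr T @ map uminus T @ map rot T"
    unfolding w_def concat_replicate_4 app T by (simp add: comp_def c)
  with boxed_ring[OF b assms(2,3)] have d: "distinct (trace 0 (map G (steps w)))"
    and s: "sum_list (map G (steps w)) = 0"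
    unfolding T_def by simp_all
  show "distinct (trace 0 (steps w))"
    using d by (simp add: trace_map_0[OF G(1)] distinct_map)
  show "sum_list (steps w) = 0"
    using s G injD[OF G(2), of "sum_list (steps w)" 0]
    by (simp add: sum_list_map_additive additive.zero)
qed

lemma refine_funpow_drawn:
  assumes "drawn a b G u v" "a \<ge> 1" "b \<ge> 0" "(refine ^^ k) (u, v) = (u', v')"
  shows "\<exists>a b G. drawn a b G u' v' \<and> a \<ge> 1 \<and> b \<ge> 0"
  using assms(4)
proof (induction k arbitrary: u' v')
  case (Suc k)
  obtain u'' v'' where uv: "(refine ^^ k) (u, v) = (u'', v'')" by force
  with Suc obtain a b G where "drawn a b G u'' v''" "a \<ge> 1" "b \<ge> 0" by blast
  moreover have "refine (u'', v'') = (u', v')" using Suc.prems uv by simp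
  ultimately have "drawn (a + 2 * b) (a + b) (neg_swap_xy \<circ> G) u' v'" "a + 2 * b \<ge> 1" "a + b \<ge> 0"
    using drawn_refine by auto
  then show ?case by blast
qed (use assms in auto)

section \<open>The initial zigzags and the words \<open>q\<close>\<close>

abbreviation zigzag :: "nat \<Rightarrow> word4" where
  "zigzag j \<equiv> concat (replicate j [1, 3])"

lemma sum_list_zigzag [simp]: "sum_list (zigzag j) = 0"
  by (induction j) simp_all

lemma steps_zigzag: "steps (zigzag j) = concat (replicate j [(1, 0), (0, 1)])"
proof (induction j)
  case (Suc j)
  have "steps (zigzag (Suc j)) = steps ([1, 3] @ zigzag j)" by simp
  also have "\<dots> = steps [1, 3] @ steps (zigzag j)"
    unfolding steps_append by (simp add: rot4_def)
  finally show ?case using Suc by (simp add: steps_def Sigma_circ_Cons step_def)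
qed (simp add: steps_def)

lemma trace_zigzag_flat:
  "distinct (trace z (concat (replicate j [(1, -1), (1, 1)]))) \<and>
   set (trace z (concat (replicate j [(1, -1), (1, 1)]))) \<subseteq>
     {((x, y), s). 2 * fst z < x \<and> x < 2 * fst z + 4 * int j \<and> y = 2 * snd z - 1}"
proof (induction j arbitrary: z)
  case (Suc j)
  show ?case using Suc[of "z + (2, 0)"] by (cases z) (auto simp: add.assoc)
qed simp

text \<open>After its first two steps the staircase has moved by \<open>(1, 1)\<close>, and the rest
  stays strictly to the right of and above their midpoints. It meets its square's boundary only in a
  step up on the left side and a step to the right on the top side.\<close>

lemma trace_zigzag_diagonal:
  "distinct (trace (p, r) (concat (replicate j [(0, 1), (1, 0)]))) \<and>
   (\<forall>x y s. ((x, y), s) \<in> set (trace (p, r) (concat (replicate j [(0, 1), (1, 0)]))) \<longrightarrow>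
     2 * p \<le> x \<and> x < 2 * p + 2 * int j \<and> 2 * r < y \<and> y \<le> 2 * r + 2 * int j \<and>
     (x = 2 * p \<longrightarrow> s = (0, 1)) \<and> (y = 2 * r + 2 * int j \<longrightarrow> s = (1, 0)))"
proof (induction j arbitrary: p r)
  case (Suc j)
  define R where "R = trace (p + 1, r + 1) (concat (replicate j [(0, 1), (1, 0)]))"
  have tr: "trace (p, r) (concat (replicate (Suc j) [(0, 1), (1, 0)])) =
      ((2 * p, 2 * r + 1), (0, 1)) # ((2 * p + 1, 2 * r + 2), (1, 0)) # R"
    by (simp add: R_def)
  have d: "distinct R" and R: "\<And>x y s. ((x, y), s) \<in> set R \<Longrightarrow>
      2 * p + 2 \<le> x \<and> x < 2 * p + 2 + 2 * int j \<and> 2 * r + 2 < y \<and> y \<le> 2 * r + 2 + 2 * int j \<and>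
      (y = 2 * r + 2 + 2 * int j \<longrightarrow> s = (1, 0))"
    using Suc[of "p + 1" "r + 1"] unfolding R_def[symmetric] distrib_left mult_1_right by blast+
  have notin: "((2 * p, 2 * r + 1), (0, 1)) \<notin> set R" "((2 * p + 1, 2 * r + 2), (1, 0)) \<notin> set R"
    using R[of "2 * p" "2 * r + 1" "(0, 1)"] R[of "2 * p + 1" "2 * r + 2" "(1, 0)"] by auto
  have bound: "2 * p \<le> x \<and> x < 2 * p + 2 * int (Suc j) \<and> 2 * r < y \<and> y \<le> 2 * r + 2 * int (Suc j) \<and>
     (x = 2 * p \<longrightarrow> s = (0, 1)) \<and> (y = 2 * r + 2 * int (Suc j) \<longrightarrow> s = (1, 0))"
    if mem: "((x, y), s) \<in> set (((2 * p, 2 * r + 1), (0, 1)) # ((2 * p + 1, 2 * r + 2), (1, 0)) # R)" for x y s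
  proof -
    consider "x = 2 * p" "y = 2 * r + 1" "s = (0, 1)" | "x = 2 * p + 1" "y = 2 * r + 2" "s = (1, 0)"
      | "((x, y), s) \<in> set R"
      using mem by auto
    then show ?thesis
    proof cases
      case 1
      then have "y \<noteq> 2 * r + 2 * int (Suc j)" by presburger
      with 1 show ?thesis by simp
    next
      case 2
      then have "x \<noteq> 2 * p" by presburger
      with 2 show ?thesis by simp
    qed (use R[of x y s] in auto)
  qed
  have "distinct (((2 * p, 2 * r + 1), (0, 1)) # ((2 * p + 1, 2 * r + 2), (1, 0)) # R)"
    using d notin by simp
  then show ?case unfolding tr using bound by blast
qed simp

text \<open>The map is the rotation by -45 degrees, scaled by the square root of 2. It makes the
  chord of the zigzag horizontal and puts all midpoints strictly inside the boxes, so that the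
  conditions on the sides hold vacuously.\<close>

lemma drawn_zigzag_even:
  assumes "j \<ge> 1"
  shows "drawn (2 * int j) 1 (\<lambda>(x, y). (x + y, y - x)) (zigzag j) [1]"
proof -
  let ?G = "\<lambda>(x, y). (x + y, y - x) :: int \<times> int"
  have "framed ?G (zigzag j) [1]"
    unfolding framed_def additive_def
    by (auto intro!: injI simp: rot4_def sym_defs)
  moreover have "map ?G (steps (zigzag j)) = concat (replicate j [(1, -1), (1, 1)])"
    by (simp add: steps_zigzag map_concat)
  moreover have "map (rot \<circ> ?G) (steps [1]) = [(1, 1)]"
    by (simp add: steps_def Sigma_circ_Cons step_def rot_def)
  moreover have "sum_list (concat (replicate j [(1, -1), (1, 1)])) = (2 * int j, 0 :: int)"
    by (induction j) (simp_all add: zero_prod_def)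
  ultimately show ?thesis
    using trace_zigzag_flat[of 0 j] assms
    by (auto simp: drawn_def boxed_def regU_def regV_def)
qed

lemma drawn_zigzag_odd: "drawn 1 (int j) mirror [1] (zigzag j)"
proof -
  have "framed mirror [1] (zigzag j)"
    unfolding framed_def by (intro conjI additive_syms inj_syms) (auto simp: rot4_def sym_defs)
  moreover have "map (rot \<circ> mirror) (steps (zigzag j)) = concat (replicate j [(0, 1), (1, 0)])"
    by (simp add: steps_zigzag map_concat sym_defs)
  moreover have "map mirror (steps [1]) = [(1, 0)]"
    by (simp add: steps_def Sigma_circ_Cons step_def mirror_def)
  moreover have "sum_list (concat (replicate j [(0, 1), (1, 0)])) = (int j, int j)"
    by (induction j) (simp_all add: zero_prod_def)
  moreover have "set (trace 0 (concat (replicate j [(0, 1), (1, 0)]))) \<subseteq> regV (int j)"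
  proof (intro subrelI)
    fix m s assume ms: "(m, s) \<in> set (trace 0 (concat (replicate j [(0, 1), (1, 0)])))"
    obtain x y t t' where "m = (x, y)" "s = (t, t')" by (metis prod.exhaust)
    then show "(m, s) \<in> regV (int j)"
      using trace_zigzag_diagonal[of 0 0 j, THEN conjunct2, rule_format, of x y s] ms
      by (auto simp: regV_def zero_prod_def)
  qed
  ultimately show ?thesis
    using trace_zigzag_diagonal[of 0 0 j]
    by (simp add: drawn_def boxed_def regU_def zero_prod_def)
qed

lemma q_rec:
  assumes "n \<ge> 1" "m = n + 1" "l = n + 2"
  shows "q i l = q i m @ (if l mod 3 = (if even i then 1 else 0) then q i n else bar (q i n))"
proof -
  obtain n' where "n = Suc n'" using assms by (cases n) auto
  then show ?thesis using assms by simp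
qed

lemma q_even:
  "(q (2 * j) (3 * k + 2), q (2 * j) (3 * k + 1)) = (refine ^^ k) (zigzag j, [1])"
proof (induction k)
  case 0
  show ?case using q.simps(3)[folded numeral_2_eq_2, of "2 * j"] by simp
next
  case (Suc k)
  let ?q = "q (2 * j)"
  have "(3 * k + 3) mod 3 \<noteq> 1" "(3 * k + 4) mod 3 = 1" "(3 * k + 5) mod 3 \<noteq> 1"
    by presburger+
  then have "?q (3 * k + 3) = ?q (3 * k + 2) @ bar (?q (3 * k + 1))"
    "?q (3 * k + 4) = ?q (3 * k + 3) @ ?q (3 * k + 2)"
    "?q (3 * k + 5) = ?q (3 * k + 4) @ bar (?q (3 * k + 3))"
    by (subst q_rec[of "3 * k + 1" "3 * k + 2"] q_rec[of "3 * k + 2" "3 * k + 3"]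
        q_rec[of "3 * k + 3" "3 * k + 4"]; simp)+
  moreover have e: "3 * Suc k + 2 = 3 * k + 5" "3 * Suc k + 1 = 3 * k + 4" by simp_all
  ultimately show ?case
    unfolding e funpow.simps(2) comp_apply Suc[symmetric] by (simp add: refine_def)
qed

text \<open>For odd \<open>i\<close> the zigzag takes the role of the word of index 0 in the recursion, although
  that word is defined to be empty.\<close>

lemma q_odd:
  assumes "k \<ge> 1"
  shows "(q (2 * j + 1) (3 * k + 1), q (2 * j + 1) (3 * k)) = (refine ^^ k) ([1], zigzag j)"
  using assms
proof (induction k rule: dec_induct)
  let ?q = "q (2 * j + 1)"
  \<comment> \<open>\<open>q i 2\<close> ends with the letter 1, whereas \<open>refine\<close>
    produces the 1 in front of the barred zigzag.\<close>
  have "zigzag j @ [1] = 1 # bar (zigzag j)"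
    by (induction j) (simp_all add: bar_eq)
  moreover have "?q 2 = zigzag j @ [1]" "?q 1 = [1]"
    using q.simps(3)[folded numeral_2_eq_2, of "2 * j + 1"] by simp_all
  moreover have "?q 3 = ?q 2 @ ?q 1" "?q 4 = ?q 3 @ bar (?q 2)"
    by (subst q_rec[of 1 2] q_rec[of 2 3]; simp)+
  ultimately show "(?q (3 * 1 + 1), ?q (3 * 1)) = (refine ^^ 1) ([1], zigzag j)"
    by (simp add: refine_def bar_eq)
next
  fix k :: nat assume k: "1 \<le> k"
  let ?q = "q (2 * j + 1)"
  assume IH: "(?q (3 * k + 1), ?q (3 * k)) = (refine ^^ k) ([1], zigzag j)"
  have "(3 * k + 2) mod 3 \<noteq> 0" "(3 * k + 3) mod 3 = 0" "(3 * k + 4) mod 3 \<noteq> 0"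
    by presburger+
  then have "?q (3 * k + 2) = ?q (3 * k + 1) @ bar (?q (3 * k))"
    "?q (3 * k + 3) = ?q (3 * k + 2) @ ?q (3 * k + 1)"
    "?q (3 * k + 4) = ?q (3 * k + 3) @ bar (?q (3 * k + 2))"
    using k by (subst q_rec[of "3 * k" "3 * k + 1"] q_rec[of "3 * k + 1" "3 * k + 2"]
        q_rec[of "3 * k + 2" "3 * k + 3"]; simp)+
  moreover have e: "3 * Suc k = 3 * k + 3" "3 * k + 3 + 1 = 3 * k + 4" by simp_all
  ultimately show "(?q (3 * Suc k + 1), ?q (3 * Suc k)) = (refine ^^ Suc k) ([1], zigzag j)"
    unfolding e funpow.simps(2) comp_apply IH[symmetric] by (simp add: refine_def)
qed

definition quarter :: "nat \<Rightarrow> nat \<Rightarrow> word4" where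
  "quarter i n = (if even i then q i (3 * n) else q i (3 * n + 2))"

text \<open>The last step of the recursion provides the splitting. For even \<open>i\<close> the
  index \<open>3 * n\<close> leaves room for only \<open>n - 1\<close> refinements, for odd
  \<open>i\<close> the index \<open>3 * n + 2\<close> for \<open>n\<close> of them.\<close>

lemma quarter_refine:
  assumes "i > 0" "n \<ge> 1"
  obtains j k u v where "i = 2 * j" "j \<ge> 1" "n = Suc k" "(refine ^^ k) (zigzag j, [1]) = (u, v)"
      "quarter i n = u @ bar v"
    | j u v where "i = 2 * j + 1" "(refine ^^ n) ([1], zigzag j) = (u, v)" "quarter i n = u @ bar v"
proof (cases "even i")
  case True
  then obtain j where j: "i = 2 * j" "j \<ge> 1" using assms by (auto elim!: evenE)
  obtain k where k: "n = Suc k" using assms by (cases n) auto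
  have "(3 * k + 3) mod 3 \<noteq> 1" by presburger
  then have "q i (3 * k + 3) = q i (3 * k + 2) @ bar (q i (3 * k + 1))"
    using True by (subst q_rec[of "3 * k + 1" "3 * k + 2"]) simp_all
  moreover have "3 * n = 3 * k + 3" using k by simp
  ultimately have "quarter i n = q (2 * j) (3 * k + 2) @ bar (q (2 * j) (3 * k + 1))"
    unfolding quarter_def j(1) by simp
  then show ?thesis by (rule that(1)[OF j k q_even[of j k, symmetric]])
next
  case False
  then obtain j where j: "i = 2 * j + 1" by (auto elim!: oddE)
  have "(3 * n + 2) mod 3 \<noteq> 0" by presburger
  then have "q i (3 * n + 2) = q i (3 * n + 1) @ bar (q i (3 * n))"
    using False assms by (subst q_rec[of "3 * n" "3 * n + 1"]) simp_all
  then have "quarter i n = q (2 * j + 1) (3 * n + 1) @ bar (q (2 * j + 1) (3 * n))"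
    unfolding quarter_def j by simp
  then show ?thesis by (rule that(2)[OF j q_odd[OF assms(2), of j, symmetric]])
qed

lemma quarter_closed:
  assumes "i > 0" "n \<ge> 1"
  defines "w \<equiv> concat (replicate 4 (quarter i n))"
  shows "distinct (trace 0 (steps w))" and "sum_list (steps w) = 0"
proof -
  obtain a b G u v where "drawn a b G u v" "a \<ge> 1" "b \<ge> 0" and "quarter i n = u @ bar v"
  proof (rule quarter_refine[OF assms(1,2)])
    fix j k u v
    assume *: "j \<ge> 1" "(refine ^^ k) (zigzag j, [1]) = (u, v)" "quarter i n = u @ bar v"
    have "1 \<le> 2 * int j" using * by simp
    from refine_funpow_drawn[OF drawn_zigzag_even this _ *(2)] * show thesis using that by auto
  next
    fix j u v
    assume *: "(refine ^^ n) ([1], zigzag j) = (u, v)" "quarter i n = u @ bar v"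
    from refine_funpow_drawn[OF drawn_zigzag_odd _ _ *(1)] * show thesis using that by auto
  qed
  then show "distinct (trace 0 (steps w))" and "sum_list (steps w) = 0"
    unfolding w_def using drawn_closed by simp_all
qed

section \<open>Regions bounded by closed paths\<close>

lemma vertex_Suc: "k < length w \<Longrightarrow> vertex p w (Suc k) = vertex p w k + step (w ! k)"
  by (simp add: vertex_def take_Suc_conv_app_nth add.assoc)

lemma vertex_0 [simp]: "vertex p w 0 = p"
  by (simp add: vertex_def)

abbreviation hedge :: "int \<Rightarrow> int \<Rightarrow> (int \<times> int) set" where
  "hedge x y \<equiv> {(x, y), (x + 1, y)}"

abbreviation vedge :: "int \<Rightarrow> int \<Rightarrow> (int \<times> int) set" where
  "vedge x y \<equiv> {(x, y), (x, y + 1)}"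

lemma sides_eq: "sides (x, y) = {hedge x y, vedge (x + 1) y, hedge x (y + 1), vedge x y}"
  by (simp add: sides_def insert_commute)

lemma hedge_eq_iff: "hedge x y = hedge a b \<longleftrightarrow> x = a \<and> y = b"
  unfolding doubleton_eq_iff prod.inject by presburger

lemma vedge_eq_iff: "vedge x y = vedge a b \<longleftrightarrow> x = a \<and> y = b"
  unfolding doubleton_eq_iff prod.inject by presburger

lemma hedge_neq_vedge: "hedge x y \<noteq> vedge a b"
  unfolding doubleton_eq_iff prod.inject by presburger

lemma hedge_in_sides: "hedge x y \<in> sides c \<longleftrightarrow> c = (x, y) \<or> c = (x, y - 1)"
proof (cases c)
  case (Pair a b)
  show ?thesis
    unfolding Pair sides_eq insert_iff hedge_eq_iff empty_iff prod.inject
    using hedge_neq_vedge by (metis add_diff_cancel_right' diff_add_cancel)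
qed

lemma vedge_in_sides: "vedge x y \<in> sides c \<longleftrightarrow> c = (x, y) \<or> c = (x - 1, y)"
proof (cases c)
  case (Pair a b)
  show ?thesis
    unfolding Pair sides_eq insert_iff vedge_eq_iff empty_iff prod.inject
    using hedge_neq_vedge by (metis add_diff_cancel_right' diff_add_cancel)
qed

definition rising :: "int \<times> int \<Rightarrow> int \<times> int \<Rightarrow> int \<Rightarrow> int" where
  "rising p r y = (if snd p = y \<and> snd r = y + 1 then 1 else if snd p = y + 1 \<and> snd r = y then -1 else 0)"

text \<open>The condition \<open>fst p > x\<close> selects the vertical steps met by the ray that
  goes to the right from the centre of the square \<open>(x, y)\<close>.\<close>

definition crossing :: "int \<times> int \<Rightarrow> int \<times> int \<Rightarrow> int \<Rightarrow> int \<Rightarrow> int" where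
  "crossing p r x y = (if fst p > x \<and> fst r = fst p then rising p r y else 0)"

definition vsign :: "int \<times> int \<Rightarrow> int \<times> int \<Rightarrow> int \<Rightarrow> int \<Rightarrow> int" where
  "vsign p r x y = (if fst p = x \<and> fst r = x then rising p r y else 0)"

definition hsign :: "int \<times> int \<Rightarrow> int \<times> int \<Rightarrow> int \<Rightarrow> int \<Rightarrow> int" where
  "hsign p r x y = (if snd p = y \<and> snd r = y then
     (if fst p = x \<and> fst r = x + 1 then 1 else if fst p = x + 1 \<and> fst r = x then -1 else 0) else 0)"

lemma crossing_vsign: "crossing p r (x - 1) y = crossing p r x y + vsign p r x y"
  by (auto simp: crossing_def vsign_def)

text \<open>Moving the ray down by one row changes the count by the horizontal edge in between, up
  to the change of the indicator of a half-line of lattice points. Along a closed path these changes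
  telescope to 0.\<close>

lemma crossing_hsign:
  assumes "r = p + step a"
  shows "crossing p r x (y - 1) - crossing p r x y + hsign p r x y =
    of_bool (snd r = y \<and> fst r > x) - of_bool (snd p = y \<and> fst p > x)"
  using assms by (cases p) (auto simp: crossing_def hsign_def rising_def step_def)

text \<open>To the left of the path every vertical step is met by the ray, so the count
  telescopes.\<close>

lemma crossing_far:
  assumes "r = p + step a" "fst p > x" 
  shows "crossing p r x y = of_bool (snd r > y) - of_bool (snd p > y)"
  using assms by (cases p) (auto simp: crossing_def rising_def step_def)

text \<open>By injectivity at most one summand is nonzero, and that one is 1 or -1. This is where
  using no edge twice makes the parity change across each edge of the path.\<close>

lemma odd_sum_iff:
  assumes "inj_on E {..<n::nat}" and "\<And>k. k < n \<Longrightarrow> f k \<noteq> 0 \<longleftrightarrow> E k = e"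
    and "\<And>k. k < n \<Longrightarrow> \<bar>f k\<bar> \<le> (1 :: int)"
  shows "odd (\<Sum>k<n. f k) \<longleftrightarrow> e \<in> E ` {..<n}"
proof (cases "e \<in> E ` {..<n}")
  case True
  then obtain k where k: "k < n" "E k = e" by auto
  have "f l = 0" if "l < n" "l \<noteq> k" for l
    using assms(1,2) k that by (auto simp: inj_on_def)
  then have "(\<Sum>l<n. f l) = (\<Sum>l<n. if l = k then f k else 0)" by (intro sum.cong) auto
  also have "\<dots> = f k" using k by simp
  finally have "(\<Sum>l<n. f l) = f k" .
  moreover have "f k = 1 \<or> f k = -1" using assms(2,3)[of k] k by force
  ultimately show ?thesis using True by auto
next
  case False
  then have "(\<Sum>k<n. f k) = 0" using assms(2) by (intro sum.neutral) auto
  then show ?thesis using False by simp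
qed

text \<open>The region consists of the squares around which the path has odd winding number,
  computed as the signed number of crossings with the ray from the square to the right.\<close>

lemma closed_path_bounds_region:
  assumes "closed_path w" "inj_on (edge 0 w) {..<length w}" "w \<noteq> []"
  shows "\<exists>P. finite P \<and> P \<noteq> {} \<and> boundary_edges P = edge 0 w ` {..<length w}"
proof -
  define n where "n = length w"
  define v where "v = vertex 0 w"
  define E where "E = edge 0 w"
  have v_Suc: "v (Suc k) = v k + step (w ! k)" if "k < n" for k
    using that by (simp add: v_def n_def vertex_Suc)
  have v_0: "v 0 = 0" and v_n: "v n = 0"
    using assms(1) by (simp_all add: v_def n_def vertex_def closed_path_def)
  have E: "E k = {v k, v (Suc k)}" for k by (simp add: E_def edge_def v_def)
  have inj: "inj_on E {..<n}" using assms(2) by (simp add: E_def n_def)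
  define W where "W x y = (\<Sum>k<n. crossing (v k) (v (Suc k)) x y)" for x y
  have tele: "(\<Sum>k<n. g (v (Suc k)) - g (v k)) = (0 :: int)" for g
    using sum_lessThan_telescope[of "\<lambda>k. g (v k)" n] by (simp add: v_0 v_n)
  have vert: "W (x - 1) y = W x y + (\<Sum>k<n. vsign (v k) (v (Suc k)) x y)" for x y
    by (simp add: W_def crossing_vsign sum.distrib)
  have hor: "W x (y - 1) = W x y - (\<Sum>k<n. hsign (v k) (v (Suc k)) x y)" for x y
  proof -
    have "(\<Sum>k<n. crossing (v k) (v (Suc k)) x (y - 1) - crossing (v k) (v (Suc k)) x y
        + hsign (v k) (v (Suc k)) x y) = 
      (\<Sum>k<n. of_bool (snd (v (Suc k)) = y \<and> fst (v (Suc k)) > x) - of_bool (snd (v k) = y \<and> fst (v k) > x))"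
      by (intro sum.cong refl) (simp only: lessThan_iff crossing_hsign[OF v_Suc])
    also have "\<dots> = 0" by (rule tele)
    finally show ?thesis by (simp add: W_def sum.distrib sum_subtractf)
  qed
  have step_cases: "step a \<in> {(1, 0), (0, 1), (-1, 0), (0, -1)}" for a
    by (simp add: step_def)
  have vE: "odd (W (x - 1) y) \<noteq> odd (W x y) \<longleftrightarrow> vedge x y \<in> E ` {..<n}" for x y
  proof -
    have "odd (\<Sum>k<n. vsign (v k) (v (Suc k)) x y) \<longleftrightarrow> vedge x y \<in> E ` {..<n}"
    proof (rule odd_sum_iff[OF inj])
      fix k assume "k < n"
      then show "vsign (v k) (v (Suc k)) x y \<noteq> 0 \<longleftrightarrow> E k = vedge x y"
        using v_Suc[of k] step_cases[of "w ! k"] unfolding E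
        by (cases "v k"; cases "v (Suc k)") (auto simp: vsign_def rising_def doubleton_eq_iff)
    qed (auto simp: vsign_def rising_def)
    then show ?thesis by (simp add: vert) blast
  qed
  have hE: "odd (W x (y - 1)) \<noteq> odd (W x y) \<longleftrightarrow> hedge x y \<in> E ` {..<n}" for x y
  proof -
    have "odd (\<Sum>k<n. hsign (v k) (v (Suc k)) x y) \<longleftrightarrow> hedge x y \<in> E ` {..<n}"
    proof (rule odd_sum_iff[OF inj])
      fix k assume "k < n"
      then show "hsign (v k) (v (Suc k)) x y \<noteq> 0 \<longleftrightarrow> E k = hedge x y"
        using v_Suc[of k] step_cases[of "w ! k"] unfolding E
        by (cases "v k"; cases "v (Suc k)") (auto simp: hsign_def doubleton_eq_iff)
    qed (auto simp: hsign_def)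
    then show ?thesis by (simp add: hor) blast
  qed
  define P where "P = {(x, y). odd (W x y)}"
  have edges: "boundary_edges P = E ` {..<n}"
  proof (intro set_eqI iffI)
    fix e assume "e \<in> boundary_edges P"
    then obtain x y d where c: "odd (W x y)" "d \<notin> P" "e \<in> sides (x, y)" "e \<in> sides d"
      by (auto simp: boundary_edges_def P_def)
    then consider (h) y' where "e = hedge x y'" "y' = y \<or> y' = y + 1"
      | (v) x' where "e = vedge x' y" "x' = x \<or> x' = x + 1"
      by (auto simp: sides_eq)
    then show "e \<in> E ` {..<n}"
    proof cases
      case h
      with c(4) have "d = (x, y') \<or> d = (x, y' - 1)" by (simp add: hedge_in_sides)
      with c(1,2) h have "odd (W x (y' - 1)) \<noteq> odd (W x y')" by (auto simp: P_def)
      then show ?thesis using hE h by simp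
    next
      case v
      with c(4) have "d = (x', y) \<or> d = (x' - 1, y)" by (simp add: vedge_in_sides)
      with c(1,2) v have "odd (W (x' - 1) y) \<noteq> odd (W x' y)" by (auto simp: P_def)
      then show ?thesis using vE v by simp
    qed
  next
    fix e assume e: "e \<in> E ` {..<n}"
    then obtain k where k: "k < n" "e = E k" by auto
    obtain x y where "e = hedge x y \<or> e = vedge x y"
    proof -
      obtain a b where ab: "v k = (a, b)" by force
      then consider "v (Suc k) = (a + 1, b)" | "v (Suc k) = (a, b + 1)"
        | "v (Suc k) = (a - 1, b)" | "v (Suc k) = (a, b - 1)"
        using v_Suc[OF k(1)] step_cases[of "w ! k"] by auto
      then have "e = hedge a b \<or> e = vedge a b \<or> e = hedge (a - 1) b \<or> e = vedge a (b - 1)"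
        unfolding k(2) E ab by cases (simp_all only: diff_add_cancel insert_commute simp_thms)
      then show thesis using that by blast
    qed
    then show "e \<in> boundary_edges P"
    proof
      assume h: "e = hedge x y"
      then have "odd (W x (y - 1)) \<noteq> odd (W x y)" using hE e by simp
      then have "(x, y - 1) \<in> P \<and> (x, y) \<notin> P \<or> (x, y) \<in> P \<and> (x, y - 1) \<notin> P" by (auto simp: P_def)
      moreover have "e \<in> sides (x, y)" "e \<in> sides (x, y - 1)" unfolding h hedge_in_sides by simp_all
      ultimately show ?thesis unfolding boundary_edges_def by blast
    next
      assume h: "e = vedge x y"
      then have "odd (W (x - 1) y) \<noteq> odd (W x y)" using vE e by simp
      then have "(x - 1, y) \<in> P \<and> (x, y) \<notin> P \<or> (x, y) \<in> P \<and> (x - 1, y) \<notin> P" by (auto simp: P_def)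
      moreover have "e \<in> sides (x, y)" "e \<in> sides (x - 1, y)" unfolding h vedge_in_sides by simp_all
      ultimately show ?thesis unfolding boundary_edges_def by blast
    qed
  qed
  \<comment> \<open>Outside a box around the path all winding numbers vanish: above, below and to
    the right nothing crosses the ray, to the left \<open>crossing_far\<close> applies. Hence
    \<open>P\<close> is finite.\<close>
  have bound: "\<bar>fst (v k)\<bar> \<le> int k \<and> \<bar>snd (v k)\<bar> \<le> int k" if "k \<le> n" for k
    using that
  proof (induction k)
    case (Suc k)
    then show ?case using v_Suc[of k] step_cases[of "w ! k"] by (cases "v k") auto
  qed (simp add: v_0)
  have bound_n: "\<bar>fst (v k)\<bar> \<le> int n \<and> \<bar>snd (v k)\<bar> \<le> int n" if "k \<le> n" for k
    using bound[OF that] that by auto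
  have "W x y = 0" if "x > int n \<or> \<bar>y\<bar> > int n + 1" for x y
    unfolding W_def
  proof (rule sum.neutral, intro ballI)
    fix k assume "k \<in> {..<n}"
    then show "crossing (v k) (v (Suc k)) x y = 0"
      using that bound_n[of k] bound_n[of "Suc k"] by (auto simp: crossing_def rising_def)
  qed
  moreover have "W x y = 0" if "x < - int n" for x y
  proof -
    have "W x y = (\<Sum>k<n. of_bool (snd (v (Suc k)) > y) - of_bool (snd (v k) > y))"
      unfolding W_def
    proof (intro sum.cong refl crossing_far)
      fix k assume "k \<in> {..<n}"
      then show "v (Suc k) = v k + step (w ! k)" "fst (v k) > x"
        using v_Suc bound_n[of k] that by auto
    qed
    also have "\<dots> = 0" by (rule tele)
    finally show ?thesis .
  qed
  ultimately have "P \<subseteq> {- int n..int n} \<times> {- int n - 1..int n + 1}"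
    unfolding P_def by (force simp: not_less[symmetric])
  then have "finite P" by (rule finite_subset) simp
  moreover have "P \<noteq> {}"
  proof
    assume "P = {}"
    then have "E ` {..<n} = {}" using edges by (simp add: boundary_edges_def)
    moreover have "0 \<in> {..<n}" using assms(3) by (simp add: n_def)
    ultimately show False by blast
  qed
  ultimately show ?thesis using edges by (auto simp: E_def n_def)
qed

section \<open>Paths that turn at every vertex\<close>

lemma length_trace [simp]: "length (trace z ss) = length ss"
  by (induction ss arbitrary: z) simp_all

lemma nth_trace:
  "k < length ss \<Longrightarrow> trace z ss ! k =
     (z + sum_list (take k ss) + (z + sum_list (take k ss)) + ss ! k, ss ! k)"
proof (induction ss arbitrary: z k)
  case (Cons s ss)
  then show ?case by (cases k) (simp_all add: add.assoc)
qed simp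

lemma length_Sigma_circ [simp]: "length (Sigma_circ \<alpha> t) = length t"
  by (simp add: Sigma_circ_def)

lemma nth_Sigma_circ: "k < length t \<Longrightarrow> Sigma_circ \<alpha> t ! k = \<alpha> + sum_list (take k t)"
  by (simp add: Sigma_circ_def)

definition vertical :: "4 \<Rightarrow> bool" where
  "vertical a \<longleftrightarrow> a = 1 \<or> a = 3"

lemma vertical_add: "vertical (a + b) \<longleftrightarrow> vertical a \<noteq> vertical b"
  using four_cases[of a] four_cases[of b] by (elim disjE) (simp_all add: vertical_def)

lemma vertical_sum_list: "set t \<subseteq> {1, 3} \<Longrightarrow> vertical (sum_list t) \<longleftrightarrow> odd (length t)"
  by (induction t) (auto simp: vertical_add, auto simp: vertical_def)

text \<open>Horizontal and vertical steps alternate, and so do the parities of the vertices, so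
  horizontal steps all start at vertices of one parity. The reversed edge would start at a vertex of
  the other parity, hence no edge is used in both directions; distinctness of the trace excludes the
  same direction. No passage goes straight on, so there are no crossings.\<close>

lemma non_crossing_Sigma_circ:
  assumes t: "set t \<subseteq> {1, 3}" "even (length t)" and d: "distinct (trace 0 (steps t))"
  shows "non_crossing (Sigma_circ \<alpha> t)"
proof -
  define w where "w = Sigma_circ \<alpha> t"
  define n where "n = length w"
  have n: "n = length t" by (simp add: n_def w_def)
  have vert: "vertical (w ! k) \<longleftrightarrow> vertical \<alpha> \<noteq> odd k" if "k < n" for k
  proof -
    have "set (take k t) \<subseteq> {1, 3}" using t(1) by (meson set_take_subset subset_trans)
    then show ?thesis
      using that n by (simp add: w_def nth_Sigma_circ vertical_add vertical_sum_list)
  qed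
  have v_Suc: "vertex 0 w (Suc k) = vertex 0 w k + step (w ! k)" if "k < n" for k
    using that by (simp add: n_def vertex_Suc)
  have step_odd: "odd (fst (step a) + snd (step a))" for a by (simp add: step_def)
  have parity: "odd (fst (vertex 0 w k) + snd (vertex 0 w k)) \<longleftrightarrow> odd k" if "k \<le> n" for k
    using that
  proof (induction k)
    case (Suc k)
    have "fst (vertex 0 w (Suc k)) + snd (vertex 0 w (Suc k)) =
       (fst (vertex 0 w k) + snd (vertex 0 w k)) + (fst (step (w ! k)) + snd (step (w ! k)))"
      using v_Suc[of k] Suc.prems by simp
    then show ?case using Suc step_odd[of "w ! k"] by simp
  qed simp
  have "distinct (trace 0 (map step w))"
    unfolding w_def step_Sigma_circ
    by (rule distinct_trace_map[OF additive_rot4 inj_rot4 d])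
  then have oriented: "j = k" if "vertex 0 w j = vertex 0 w k" "step (w ! j) = step (w ! k)"
      "j < n" "k < n" for j k
    using that nth_eq_iff_index_eq[of "trace 0 (map step w)" j k]
    by (simp add: n_def nth_trace take_map vertex_def)
  have "inj_on (edge 0 w) {..<n}"
  proof (rule inj_onI)
    fix j k assume "j \<in> {..<n}" "k \<in> {..<n}" and e: "edge 0 w j = edge 0 w k"
    then have jk: "j < n" "k < n" by auto
    from e consider "vertex 0 w j = vertex 0 w k" "vertex 0 w (Suc j) = vertex 0 w (Suc k)"
      | "vertex 0 w j = vertex 0 w (Suc k)" "vertex 0 w (Suc j) = vertex 0 w k"
      unfolding edge_def doubleton_eq_iff by blast
    then show "j = k"
    proof cases
      case 1
      then show ?thesis using oriented jk by (simp add: v_Suc)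
    next
      case 2
      then have "odd j \<longleftrightarrow> odd (Suc k)" using parity[of j] parity[of "Suc k"] jk by simp
      moreover have "step (w ! j) = - step (w ! k)"
      proof -
        have "vertex 0 w k + step (w ! k) + step (w ! j) = vertex 0 w k"
          using 2 jk by (simp add: v_Suc)
        then show ?thesis by (simp add: add.assoc eq_neg_iff_add_eq_0 add.commute)
      qed
      then have "vertical (w ! j) \<longleftrightarrow> vertical (w ! k)"
        using four_cases[of "w ! j"] four_cases[of "w ! k"]
        by (elim disjE) (simp_all add: step_def vertical_def)
      ultimately have False using vert[OF jk(1)] vert[OF jk(2)] by auto
      then show ?thesis ..
    qed
  qed
  moreover have "incoming w k \<noteq> w ! k" if "k < n" for k
  proof (cases k)
    case 0
    \<comment> \<open>Even length is needed here: the alternation has to continue across the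
      starting point.\<close>
    have "(n - 1) mod n = n - 1" "odd (n - 1)" using that t n by auto
    then have "vertical (w ! 0) \<noteq> vertical (w ! (n - 1))"
      using vert[of 0] vert[of "n - 1"] that by simp
    then show ?thesis using 0 that by (auto simp: incoming_def n_def[symmetric])
  next
    case (Suc l)
    then have "vertical (w ! l) \<noteq> vertical (w ! k)"
      using vert[of l] vert[of k] that by simp
    then show ?thesis using Suc that by (auto simp: incoming_def n_def[symmetric])
  qed
  ultimately show ?thesis unfolding non_crossing_def w_def[symmetric] n_def[symmetric]
    using less_trans by blast
qed

lemma set_bar: "set w \<subseteq> {1, 3} \<Longrightarrow> set (bar w) \<subseteq> {1, 3}"
  by (auto simp: bar_eq)

lemma set_refine_funpow:
  assumes "set u \<subseteq> {1, 3}" "set v \<subseteq> {1, 3}" "(refine ^^ k) (u, v) = (u', v')"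
  shows "set u' \<subseteq> {1, 3} \<and> set v' \<subseteq> {1, 3}"
  using assms(3)
proof (induction k arbitrary: u' v')
  case (Suc k)
  obtain u'' v'' where uv: "(refine ^^ k) (u, v) = (u'', v'')" by force
  have "refine (u'', v'') = (u', v')" using Suc.prems uv by simp
  with Suc.IH[OF uv] show ?case using set_bar[of u''] set_bar[of v''] by (auto simp: refine_def)
qed (use assms in auto)

lemma set_zigzag: "set (zigzag j) \<subseteq> {1, 3}"
  by (induction j) auto

lemma set_quarter:
  assumes "i > 0" "n \<ge> 1"
  shows "set (quarter i n) \<subseteq> {1, 3}"
proof (rule quarter_refine[OF assms])
  fix j k u v assume "(refine ^^ k) (zigzag j, [1]) = (u, v)" "quarter i n = u @ bar v"
  then show ?thesis using set_refine_funpow[OF set_zigzag _, of "[1]" k j u v] set_bar[of v] by auto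
next
  fix j u v assume "(refine ^^ n) ([1], zigzag j) = (u, v)" "quarter i n = u @ bar v"
  then show ?thesis using set_refine_funpow[OF _ set_zigzag, of "[1]" n j u v] set_bar[of v] by auto
qed

lemma snowflake_word_eq:
  "snowflake_word \<alpha> i n = Sigma_circ \<alpha> (concat (replicate 4 (quarter i n)))"
  by (simp add: snowflake_word_def quarter_def)

lemma snowflake_word_path:
  assumes "i > 0" "n \<ge> 1"
  shows "closed_path (snowflake_word \<alpha> i n)" and "non_crossing (snowflake_word \<alpha> i n)"
proof -
  let ?t = "concat (replicate 4 (quarter i n))"
  have "sum_list (map step (snowflake_word \<alpha> i n)) = rot4 \<alpha> 0"
    by (simp add: snowflake_word_eq step_Sigma_circ sum_list_map_additive[OF additive_rot4]
        quarter_closed(2)[OF assms])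
  then show "closed_path (snowflake_word \<alpha> i n)"
    by (simp add: closed_path_def additive.zero[OF additive_rot4])
  show "non_crossing (snowflake_word \<alpha> i n)"
    unfolding snowflake_word_eq
    using set_quarter[OF assms] quarter_closed(1)[OF assms]
    by (intro non_crossing_Sigma_circ) (auto simp: concat_replicate_4)
qed

section \<open>Reflections of periodic turn words\<close>

definition cut :: "int \<Rightarrow> (int \<Rightarrow> 'a::ab_group_add) \<Rightarrow> int \<Rightarrow> bool" where
  "cut N T j \<longleftrightarrow> (\<forall>y. y mod N \<noteq> j mod N \<longrightarrow> T (2 * j - y) = - T y)"

lemma sum_reflect_periodic:
  fixes g :: "int \<Rightarrow> complex"
  assumes "N > 0" and g: "\<And>x. g (x mod N) = g x"
  shows "(\<Sum>y\<in>{0..<N}. g (c - y)) = (\<Sum>y\<in>{0..<N}. g y)"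
proof (rule sum.reindex_bij_witness[where i = "\<lambda>y. (c - y) mod N" and j = "\<lambda>y. (c - y) mod N"])
  show "(c - (c - y) mod N) mod N = y" if "y \<in> {0..<N}" for y
    using that by (simp add: mod_diff_right_eq)
  then show "(c - (c - y) mod N) mod N = y" if "y \<in> {0..<N}" for y
    using that .
  show "g ((c - y) mod N) = g (c - y)" for y by (rule g)
qed (use assms in auto)

text \<open>Reflecting the first sum in \<open>j\<close> turns the left side into a sum of
  \<open>f (2 * j - y) + f y\<close> with weights \<open>\<chi> (2 * j - y)\<close>. All terms
  cancel except the one with \<open>y\<close> congruent to \<open>j\<close>.\<close>

lemma cut_character_sum:
  fixes f \<chi> :: "int \<Rightarrow> complex"
  assumes "N > 0" and f: "\<And>x. f (x mod N) = f x" and \<chi>: "\<And>x. \<chi> (x mod N) = \<chi> x"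
    and add: "\<And>x y. \<chi> (x + y) = \<chi> x * \<chi> y" and j: "cut N f j"
  shows "(\<Sum>y\<in>{0..<N}. f y * \<chi> y) + \<chi> j ^ 2 * (\<Sum>y\<in>{0..<N}. f y * \<chi> (- y)) = 2 * f j * \<chi> j"
proof -
  have \<chi>2: "\<chi> (2 * j - y) = \<chi> j ^ 2 * \<chi> (- y)" for y
    using add[of "2 * j" "- y"] add[of j j] by (simp add: power2_eq_square)
  have "(\<Sum>y\<in>{0..<N}. f y * \<chi> y) = (\<Sum>y\<in>{0..<N}. f (2 * j - y) * \<chi> (2 * j - y))"
    using sum_reflect_periodic[of N "\<lambda>y. f y * \<chi> y" "2 * j"] f \<chi> assms(1) by simp
  moreover have "\<chi> j ^ 2 * (\<Sum>y\<in>{0..<N}. f y * \<chi> (- y)) = (\<Sum>y\<in>{0..<N}. f y * \<chi> (2 * j - y))"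
    unfolding sum_distrib_left \<chi>2 by (simp only: mult.left_commute)
  ultimately have "(\<Sum>y\<in>{0..<N}. f y * \<chi> y) + \<chi> j ^ 2 * (\<Sum>y\<in>{0..<N}. f y * \<chi> (- y)) =
     (\<Sum>y\<in>{0..<N}. (f (2 * j - y) + f y) * \<chi> (2 * j - y))"
    by (simp add: sum.distrib distrib_right)
  also have "\<dots> = (\<Sum>y\<in>{0..<N}. if y = j mod N then 2 * f j * \<chi> j else 0)"
  proof (intro sum.cong refl)
    fix y assume y: "y \<in> {0..<N}"
    show "(f (2 * j - y) + f y) * \<chi> (2 * j - y) = (if y = j mod N then 2 * f j * \<chi> j else 0)"
    proof (cases "y = j mod N")
      case True
      then have "(2 * j - y) mod N = j mod N" by (simp add: mod_diff_right_eq)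
      then have "f (2 * j - y) = f j" "\<chi> (2 * j - y) = \<chi> j"
        using f[of "2 * j - y"] f[of j] \<chi>[of "2 * j - y"] \<chi>[of j] by simp_all
      moreover have "f y = f j" using True f by simp
      ultimately show ?thesis using True by simp
    next
      case False
      then have "y mod N \<noteq> j mod N" using y by simp
      then show ?thesis using j False by (simp add: cut_def)
    qed
  qed
  also have "\<dots> = 2 * f j * \<chi> j" using assms(1) by simp
  finally show ?thesis .
qed

text \<open>The values \<open>\<chi> j\<close> of a primitive character at the cuts \<open>j\<close> are roots of one and the same
  quadratic equation.\<close>

lemma at_most_two_cuts:
  fixes f :: "int \<Rightarrow> complex"
  assumes "N > 0" and f: "\<And>x. f (x mod N) = f x" "f j\<^sub>1 \<noteq> 0"
    and cuts: "cut N f j\<^sub>1" "cut N f j\<^sub>2" "cut N f j\<^sub>3"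
  shows "j\<^sub>1 mod N = j\<^sub>2 mod N \<or> j\<^sub>1 mod N = j\<^sub>3 mod N \<or> j\<^sub>2 mod N = j\<^sub>3 mod N"
proof (rule ccontr)
  assume distinct: "\<not> ?thesis"
  define \<chi> where "\<chi> x = cis (2 * pi * real_of_int x / real_of_int N)" for x :: int
  have add: "\<chi> (x + y) = \<chi> x * \<chi> y" for x y
    by (simp add: \<chi>_def cis_mult add_divide_distrib distrib_left)
  have N: "\<chi> (N * k) = 1" for k
    using assms(1) cis_multiple_2pi[of "real_of_int k"] by (simp add: \<chi>_def mult.assoc)
  have mod: "\<chi> (x mod N) = \<chi> x" for x
    using add[of "N * (x div N)" "x mod N"] N by simp
  have inj: "x mod N = y mod N" if "\<chi> x = \<chi> y" for x y
  proof -
    have inj: "inj_on (\<lambda>k. cis (2 * pi * real k / real (nat N))) {..<nat N}"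
      using bij_betw_roots_unity[of "nat N"] assms(1) by (simp add: bij_betw_def)
    have \<chi>_nat: "cis (2 * pi * real (nat (x mod N)) / real (nat N)) = \<chi> x" for x
    proof -
      have "cis (2 * pi * real (nat (x mod N)) / real (nat N)) = \<chi> (x mod N)"
        using assms(1) by (simp add: \<chi>_def)
      then show ?thesis by (simp only: mod)
    qed
    have "nat (x mod N) = nat (y mod N)"
    proof (rule inj_onD[OF inj])
      show "cis (2 * pi * real (nat (x mod N)) / real (nat N)) =
          cis (2 * pi * real (nat (y mod N)) / real (nat N))"
        unfolding \<chi>_nat by (rule that)
    qed (use assms(1) in \<open>auto simp: nat_less_iff\<close>)
    then show ?thesis using assms(1) by (simp add: nat_eq_iff)
  qed
  define S S' F where "S = (\<Sum>y\<in>{0..<N}. f y * \<chi> y)" and "S' = (\<Sum>y\<in>{0..<N}. f y * \<chi> (- y))"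
    and "F = (\<Sum>y\<in>{0..<N}. f y)"
  \<comment> \<open>The trivial character shows that \<open>f\<close> takes the same value at all
    cuts, so the linear coefficient of the quadratic equation does not depend on
    \<open>j\<close>.\<close>
  have F: "f j = F" if "cut N f j" for j
    using cut_character_sum[where \<chi> = "\<lambda>_. 1" and f = f and N = N and j = j] assms(1) f(1) that by (simp add: F_def)
  have S: "S + \<chi> j ^ 2 * S' = 2 * F * \<chi> j" if "cut N f j" for j
    using cut_character_sum[where \<chi> = \<chi> and f = f, OF assms(1) f(1) mod add that]
    by (simp only: S_def S'_def F[OF that])
  \<comment> \<open>The difference of the equations for two roots is divided by the difference of
    the roots.\<close>
  have *: "(\<chi> j + \<chi> k) * S' = 2 * F" if "cut N f j" "cut N f k" "j mod N \<noteq> k mod N" for j k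
  proof -
    have "(\<chi> j - \<chi> k) * ((\<chi> j + \<chi> k) * S') = (S + \<chi> j ^ 2 * S') - (S + \<chi> k ^ 2 * S')"
      by (simp add: algebra_simps power2_eq_square)
    also have "\<dots> = (\<chi> j - \<chi> k) * (2 * F)"
      unfolding S[OF that(1)] S[OF that(2)] by (simp add: algebra_simps)
    finally have "(\<chi> j - \<chi> k) * ((\<chi> j + \<chi> k) * S') = (\<chi> j - \<chi> k) * (2 * F)" .
    moreover have "\<chi> j - \<chi> k \<noteq> 0" using inj[of j k] that(3) by auto
    ultimately show ?thesis by simp
  qed
  \<comment> \<open>Three distinct roots make the quadratic polynomial vanish identically, hence
    \<open>F = 0\<close>, although \<open>F\<close> is a value of \<open>f\<close> at a cut.\<close>
  have "(\<chi> j\<^sub>2 - \<chi> j\<^sub>3) * S' = (\<chi> j\<^sub>1 + \<chi> j\<^sub>2) * S' - (\<chi> j\<^sub>1 + \<chi> j\<^sub>3) * S'"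
    by (simp add: algebra_simps)
  also have "\<dots> = 0"
    using *[OF cuts(1,2)] *[OF cuts(1,3)] distinct by simp
  finally have "(\<chi> j\<^sub>2 - \<chi> j\<^sub>3) * S' = 0" .
  moreover have "\<chi> j\<^sub>2 \<noteq> \<chi> j\<^sub>3" using inj[of j\<^sub>2 j\<^sub>3] distinct by auto
  ultimately have "S' = 0" by simp
  then have "F = 0" using *[OF cuts(1,2)] distinct by simp
  then show False using F[OF cuts(1)] f(2) by simp
qed

section \<open>Cuts of the turn word of a quarter\<close>

definition turn :: "word4 \<Rightarrow> int \<Rightarrow> 4" where
  "turn Q x = Q ! nat (x mod int (length Q))"

lemma turn_mod [simp]: "turn Q (x mod int (length Q)) = turn Q x"
  by (simp add: turn_def)

lemma turn_rotate:
  assumes "u @ v \<noteq> []"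
  shows "turn (v @ u) x = turn (u @ v) (x + int (length u))"
proof -
  define L n where "L = length (u @ v)" and "n = nat (x mod int L)"
  have "int L > 0" using assms by (simp only: L_def of_nat_0_less_iff length_greater_0_conv not_False_eq_True)
  then have xn: "x mod int L = int n" and "n < L"
    by (simp_all add: n_def nat_less_iff)
  have vu: "v @ u = rotate (length u) (u @ v)" by (simp add: rotate_append)
  have "(v @ u) ! n = (u @ v) ! ((length u + n) mod L)"
    unfolding vu using \<open>n < L\<close> by (simp only: nth_rotate L_def)
  moreover have "(x + int (length u)) mod int L = int ((length u + n) mod L)"
    using xn by (metis add.commute mod_add_right_eq of_nat_add of_nat_mod)
  moreover have "length (v @ u) = L" by (simp add: L_def)
  ultimately show ?thesis
    using xn unfolding turn_def L_def[symmetric] by (simp only: nat_int)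
qed

text \<open>The reflection in the last position sends position \<open>m\<close> of \<open>X\<close>
  to \<open>length X - Suc m\<close> modulo the period, so the cut condition is the antisymmetry of
  \<open>X\<close>.\<close>

lemma cut_antipalindrome:
  assumes "Q = X @ [s]" "bar (rev X) = X"
  shows "cut (int (length Q)) (turn Q) (int (length Q) - 1)"
  unfolding cut_def
proof (intro allI impI)
  fix y :: int
  define N m where "N = int (length Q)" and "m = nat (y mod N)"
  assume "y mod int (length Q) \<noteq> (int (length Q) - 1) mod int (length Q)"
  then have y: "y mod N \<noteq> N - 1" by (simp add: N_def assms(1))
  have N: "N = int (length X) + 1" by (simp add: N_def assms(1))
  then have "N > 0" by simp
  then have "0 \<le> y mod N" "y mod N < N" by simp_all
  then have m2: "y mod N = int m" and "int m < N - 1" using y unfolding m_def by linarith+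
  then have "m < length X" using N by linarith
  note m = this m2
  have "(2 * (N - 1) - y) mod N = (2 * (N - 1) - int m) mod N"
    using m(2) by (metis mod_diff_right_eq)
  also have "\<dots> = (N - 2 - int m + N) mod N" by (simp add: algebra_simps)
  also have "\<dots> = (N - 2 - int m) mod N" by (rule mod_add_self2)
  also have "\<dots> = int (length X - Suc m)" using m(1) N by (simp add: of_nat_diff)
  finally have "turn Q (2 * (N - 1) - y) = Q ! (length X - Suc m)"
    unfolding turn_def N_def[symmetric] by (simp only: nat_int)
  moreover have "length X - Suc m < length X" using m(1) by simp
  ultimately have "turn Q (2 * (N - 1) - y) = X ! (length X - Suc m)"
    unfolding assms(1) by (simp only: nth_append if_True)
  moreover have "X ! m = - X ! (length X - Suc m)"
    using m(1) arg_cong[OF assms(2), of "\<lambda>w. w ! m"] by (simp add: bar_eq rev_nth)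
  moreover have "turn Q y = X ! m"
    using m by (simp add: turn_def N_def assms(1) nth_append)
  ultimately show "turn Q (2 * (int (length Q) - 1) - y) = - turn Q y"
    by (simp add: N_def)
qed

lemma bar_rev: "bar (rev w) = rev (bar w)"
  by (simp add: bar_eq rev_map)

text \<open>Here \<open>u @ bar v\<close> is \<open>x s (bar y) s\<close>. The conditions say that
  \<open>x s (bar y)\<close>, and with it \<open>(bar y) s x\<close>, is sent to itself by reversal
  followed by \<open>bar\<close>, so both letters \<open>s\<close> are centres of
  reflections.\<close>

definition centered :: "word4 \<Rightarrow> word4 \<Rightarrow> bool" where
  "centered u v \<longleftrightarrow> (\<exists>x y s. u = x @ [s] \<and> v = y @ [- s] \<and> rev x = x \<and> rev y = y \<and>
     x @ s # bar y = y @ - s # bar x)"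

lemma centeredI:
  "u = x @ [s] \<Longrightarrow> v = y @ [- s] \<Longrightarrow> rev x = x \<Longrightarrow> rev y = y \<Longrightarrow>
     x @ s # bar y = y @ - s # bar x \<Longrightarrow> centered u v"
  unfolding centered_def by blast

text \<open>The new \<open>x'\<close> and \<open>y'\<close> are the refined words without their last
  letters, and \<open>s\<close> changes its sign. \<open>y'\<close> is visibly a palindrome;
  \<open>x'\<close> is one by two uses of the equation between \<open>x\<close> and
  \<open>y\<close>.\<close>

lemma centered_refine:
  assumes "centered u v" "refine (u, v) = (u', v')"
  shows "centered u' v'"
proof -
  obtain x y s where u: "u = x @ [s]" and v: "v = y @ [- s]" and pal: "rev x = x" "rev y = y"
    and sym: "x @ s # bar y = y @ - s # bar x"
    using assms(1) unfolding centered_def by blast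
  define x' y' where "x' = x @ [s] @ bar y @ [s] @ x @ [s] @ bar x @ [- s] @ y"
    and "y' = x @ [s] @ bar y @ [s] @ x"
  have bar_pal: "rev (bar x) = bar x" "rev (bar y) = bar y"
    using pal by (simp_all add: bar_rev[symmetric])
  have sym1: "y @ - s # bar x @ z = x @ s # bar y @ z" for z
    using arg_cong[OF sym, of "\<lambda>w. w @ z"] by simp
  have sym2: "bar y @ s # x @ z = bar x @ - s # y @ z" for z
    using arg_cong[OF sym, of "\<lambda>w. bar w @ z"] by simp
  have "u' = x' @ [- s]" "v' = y' @ [s]"
    using assms(2) by (simp_all add: refine_def u v x'_def y'_def)
  moreover have "rev y' = y'" by (simp add: y'_def pal bar_pal)
  moreover have "rev x' = x'"
    using sym1[of "s # x @ s # bar y @ s # x"] sym2[of "[]"] by (simp add: x'_def pal bar_pal)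
  moreover have "x' @ - s # bar y' = y' @ s # bar x'"
    using sym by (simp add: x'_def y'_def)
  ultimately show ?thesis by (intro centeredI[where x = x' and y = y' and s = "- s"]) simp_all
qed

lemma centered_refine_funpow:
  assumes "centered u v" "(refine ^^ k) (u, v) = (u', v')"
  shows "centered u' v'"
  using assms(2)
proof (induction k arbitrary: u' v')
  case (Suc k)
  obtain u'' v'' where uv: "(refine ^^ k) (u, v) = (u'', v'')" by force
  with Suc have "centered u'' v''" "refine (u'', v'') = (u', v')" by auto
  then show ?case by (rule centered_refine)
qed (use assms in auto)

lemma zigzag_Suc: "zigzag (Suc j) = zigzag j @ [1, 3]"
  by (induction j) simp_all

lemma rev_zigzag: "rev (zigzag j) = bar (zigzag j)"
proof (induction j)
  case (Suc j)
  have "bar (zigzag (Suc j)) = bar (zigzag j) @ [3, 1]"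
    unfolding zigzag_Suc by simp
  with Suc show ?case by simp
qed simp

lemma zigzag_1: "zigzag j @ [1] = 1 # bar (zigzag j)"
  by (induction j) simp_all

lemma rev_zigzag_1: "rev (zigzag j @ [1]) = zigzag j @ [1]"
  by (subst (2) zigzag_1) (simp add: rev_zigzag)

lemma centered_even:
  assumes "j \<ge> 1"
  shows "centered (zigzag j) [1]"
proof -
  obtain k where k: "j = Suc k" using assms by (cases j) auto
  have u: "zigzag j = (zigzag k @ [1]) @ [3]" unfolding k zigzag_Suc by simp
  have v: "[1] = [] @ [- (3 :: 4)]" by simp
  have "(zigzag k @ [1]) @ 3 # bar [] = (1 # bar (zigzag k)) @ [3]" by (simp only: zigzag_1 bar_Nil)
  also have "\<dots> = [] @ - 3 # bar (zigzag k @ [1])" by simp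
  finally show ?thesis by (rule centeredI[OF u v rev_zigzag_1 rev.simps(1)])
qed

lemma centered_odd:
  assumes "k \<ge> 1" "(refine ^^ k) ([1], zigzag j) = (u, v)"
  shows "centered u v"
proof (cases j)
  case 0
  \<comment> \<open>For \<open>j = 0\<close> the second word is empty and has no last letter, so the
    induction starts after one refinement.\<close>
  obtain l where "k = Suc l" using assms(1) by (cases k) auto
  moreover have "refine ([1], []) = ([1, 1, 3], [1, 1])" by (simp add: refine_def)
  ultimately have "(refine ^^ l) ([1, 1, 3], [1, 1]) = (u, v)"
    using assms(2) 0 by (simp add: funpow_Suc_right del: funpow.simps)
  moreover have "centered [1, 1, 3] [1, 1]"
    by (rule centeredI[where x = "[1, 1]" and y = "[1]" and s = 3]) simp_all
  ultimately show ?thesis using centered_refine_funpow by blast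
next
  case (Suc l)
  have u: "[1] = [] @ [1 :: 4]" by simp
  have v: "zigzag j = (zigzag l @ [1]) @ [- 1]" unfolding Suc zigzag_Suc by simp
  have "[] @ 1 # bar (zigzag l @ [1]) = (1 # bar (zigzag l)) @ [- 1]" by simp
  also have "\<dots> = (zigzag l @ [1]) @ - 1 # bar []" by (simp only: zigzag_1 bar_Nil)
  finally have "centered [1] (zigzag j)"
    by (rule centeredI[OF u v rev.simps(1) rev_zigzag_1])
  then show ?thesis using centered_refine_funpow assms(2) by blast
qed

text \<open>Modulo the period, the two positions are those of the last letters of
  \<open>bar v\<close> and of \<open>u\<close>.\<close>

lemma cuts_centered:
  assumes "centered u v"
  defines "Q \<equiv> u @ bar v"
  shows "cut (int (length Q)) (turn Q) (- 1)" "cut (int (length Q)) (turn Q) (int (length u) - 1)"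
proof -
  let ?N = "int (length Q)"
  have shift: "cut ?N T j" if "cut ?N T (j + ?N)" "\<And>x. T (x + ?N) = T x" for T :: "int \<Rightarrow> 4" and j
  proof -
    have "T (2 * (j + ?N) - y) = T (2 * j - y)" for y
      using that(2)[of "2 * j - y"] that(2)[of "2 * j - y + ?N"] by (simp add: algebra_simps)
    with that(1) show ?thesis by (simp add: cut_def)
  qed
  have per: "turn Q (x + ?N) = turn Q x" for x by (simp add: turn_def)
  obtain x y s where u: "u = x @ [s]" and v: "v = y @ [- s]" and pal: "rev x = x" "rev y = y"
    and sym: "x @ s # bar y = y @ - s # bar x"
    using assms(1) unfolding centered_def by blast
  have bar_pal: "rev (bar x) = bar x" "rev (bar y) = bar y"
    using pal by (simp_all add: bar_rev[symmetric])
  have "cut ?N (turn Q) (?N - 1)"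
  proof (rule cut_antipalindrome)
    show "Q = (x @ s # bar y) @ [s]" by (simp add: Q_def u v)
    show "bar (rev (x @ s # bar y)) = x @ s # bar y"
      using sym by (simp add: pal bar_pal)
  qed
  then show "cut ?N (turn Q) (- 1)"
    using shift[of "turn Q" "- 1"] per by simp
  have sym2: "bar y @ s # x = bar x @ - s # y"
    using arg_cong[OF sym, of bar] by simp
  \<comment> \<open>Exchanging the two halves cyclically brings the other letter \<open>s\<close> to
    the end; the index is then shifted back by \<open>length u\<close>.\<close>
  have "cut (int (length (bar v @ u))) (turn (bar v @ u)) (int (length (bar v @ u)) - 1)"
  proof (rule cut_antipalindrome)
    show "bar v @ u = (bar y @ s # x) @ [s]" by (simp add: u v)
    show "bar (rev (bar y @ s # x)) = bar y @ s # x"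
      using sym2 by (simp add: pal bar_pal)
  qed
  moreover have "length (bar v @ u) = length Q" by (simp add: Q_def)
  moreover have "turn (bar v @ u) = (\<lambda>x. turn Q (x + int (length u)))"
    unfolding Q_def by (intro ext turn_rotate) (simp add: u)
  ultimately have c: "cut ?N (\<lambda>x. turn Q (x + int (length u))) (?N - 1)"
    by (simp only:)
  have "cut ?N (turn Q) (int (length u) - 1 + ?N)"
    unfolding cut_def
  proof (intro allI impI)
    fix y assume y: "y mod ?N \<noteq> (int (length u) - 1 + ?N) mod ?N"
    have "(y - int (length u)) mod ?N \<noteq> (?N - 1) mod ?N"
    proof
      assume "(y - int (length u)) mod ?N = (?N - 1) mod ?N"
      then have "(y - int (length u) + int (length u)) mod ?N = (?N - 1 + int (length u)) mod ?N"
        by (rule mod_add_cong) simp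
      then show False using y by (simp add: algebra_simps)
    qed
    then have "turn Q (2 * (?N - 1) - (y - int (length u)) + int (length u)) =
        - turn Q (y - int (length u) + int (length u))"
      by (rule c[unfolded cut_def, rule_format])
    then show "turn Q (2 * (int (length u) - 1 + ?N) - y) = - turn Q y"
      by (simp add: algebra_simps)
  qed
  then show "cut ?N (turn Q) (int (length u) - 1)"
    using shift per by blast
qed

section \<open>Factorizations\<close>

lemma sum_list_take: "k \<le> length w \<Longrightarrow> sum_list (take k w) = (\<Sum>l<k. w ! l)"
  by (simp add: sum_list_sum_nth atLeast0LessThan)

locale turning_word =
  fixes Q :: word4 and \<alpha> :: 4
  assumes letters: "set Q \<subseteq> {1, 3}" and odd_length: "odd (length Q)"
begin

abbreviation "n \<equiv> length Q"
abbreviation "N \<equiv> int (length Q)"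
abbreviation "T \<equiv> turn Q"

definition W :: word4 where
  "W = Sigma_circ \<alpha> (concat (replicate 4 Q))"

text \<open>The boundary word is read periodically on the integers, so that factors may begin
  anywhere and wrap around.\<close>

definition H :: "int \<Rightarrow> 4" where
  "H x = W ! nat (x mod (4 * N))"

lemma n_pos: "n > 0" and N_pos: "N > 0"
  using odd_length by (auto intro: Nat.gr0I)

lemma length_W [simp]: "length W = 4 * n"
  by (simp add: W_def concat_replicate_4)

lemma turn_neq_uminus: "T x \<noteq> - T x"
proof -
  have "nat (x mod N) < n" using n_pos N_pos by (simp add: nat_less_iff)
  then have "T x \<in> set Q" by (simp add: turn_def)
  then show ?thesis using letters by auto
qed

lemma turn_neq_0: "T x \<noteq> 0"
  using turn_neq_uminus[of x] by auto

text \<open>An odd number of quarter turns adds up to 1 or 3, and twice either is 2 modulo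
  4.\<close>

lemma sum_turn: "sum_list Q + sum_list Q = 2"
proof -
  have "vertical (sum_list Q)" using vertical_sum_list[OF letters] odd_length by simp
  then show ?thesis by (auto simp: vertical_def)
qed

lemma nth_concat_replicate: "k < 4 * n \<Longrightarrow> concat (replicate 4 Q) ! k = T (int k)"
proof -
  have "k < m * n \<Longrightarrow> concat (replicate m Q) ! k = Q ! (k mod n)" for m
  proof (induction m arbitrary: k)
    case (Suc m)
    then show ?case by (cases "k < n") (auto simp: nth_append le_mod_geq not_less)
  qed simp
  moreover assume "k < 4 * n"
  ultimately show ?thesis by (simp add: turn_def zmod_int[symmetric] del: of_nat_mod)
qed

definition heading :: "nat \<Rightarrow> 4" where
  "heading m = \<alpha> + (\<Sum>k<m. T (int k))"

lemma heading_add_n: "heading (m + n) = heading m + sum_list Q"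
proof (induction m)
  case 0
  have "sum_list Q = (\<Sum>k<n. Q ! k)" by (simp add: sum_list_sum_nth atLeast0LessThan)
  also have "\<dots> = (\<Sum>k<n. T (int k))" by (intro sum.cong) (auto simp: turn_def)
  finally show ?case by (simp add: heading_def)
next
  case (Suc m)
  have "heading (Suc m + n) = heading (m + n) + T (int (m + n))" by (simp add: heading_def add.assoc)
  also have "T (int (m + n)) = T (int m)" by (simp add: turn_def)
  finally show ?case using Suc by (simp add: heading_def add.assoc add.left_commute add.commute)
qed

text \<open>By \<open>sum_turn\<close> four quarters have total turn 0, so the unreduced partial
  sums in \<open>heading\<close> already have period \<open>4 * n\<close>.\<close>

lemma H_nat: "H (int m) = heading m"
proof -
  have lt: "W ! k = heading k" if "k < 4 * n" for k
  proof -
    have "W ! k = \<alpha> + sum_list (take k (concat (replicate 4 Q)))"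
      using that by (simp add: W_def nth_Sigma_circ concat_replicate_4)
    also have "sum_list (take k (concat (replicate 4 Q))) = (\<Sum>l<k. T (int l))"
    proof (subst sum_list_take)
      show "k \<le> length (concat (replicate 4 Q))" using that by (simp add: concat_replicate_4)
    qed (use that nth_concat_replicate in \<open>auto intro!: sum.cong\<close>)
    finally show ?thesis by (simp add: heading_def)
  qed
  have four: "heading (m + 4 * n) = heading m" for m
  proof -
    have "m + 4 * n = m + n + n + n + n" by simp
    then have "heading (m + 4 * n) = heading (m + n + n + n + n)" by (rule arg_cong)
    also have "\<dots> = heading m + (sum_list Q + sum_list Q) + (sum_list Q + sum_list Q)"
      unfolding heading_add_n by (simp only: add.assoc)
    also have "\<dots> = heading m" unfolding sum_turn by simp
    finally show ?thesis .
  qed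
  have "heading (r + 4 * n * d) = heading r" for r d
  proof (induction d)
    case (Suc d)
    then show ?case using four[of "r + 4 * n * d"] by (simp add: algebra_simps)
  qed simp
  from this[of "m mod (4 * n)" "m div (4 * n)"] have "heading (m mod (4 * n)) = heading m" by simp
  moreover have "nat (int m mod (4 * N)) = m mod (4 * n)"
    by (metis nat_int of_nat_mod of_nat_mult of_nat_numeral)
  moreover have "m mod (4 * n) < 4 * n" using n_pos by simp
  ultimately show ?thesis using lt by (simp add: H_def)
qed

lemma H_periodic: "H (x + 4 * N * z) = H x"
  by (simp add: H_def)

lemma turn_periodic: "T (x + N * z) = T x"
  by (simp add: turn_def)

lemma H_shift_nat:
  "\<exists>m. (\<forall>y. H (x + y) = H (int m + y)) \<and> (\<forall>y. T (x + y) = T (int m + y))"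
proof -
  have "x = int (nat (x mod (4 * N))) + 4 * N * (x div (4 * N))"
    using N_pos by simp
  then obtain m z where x: "x = int m + 4 * N * z" by blast
  have "H (x + y) = H (int m + y)" for y
    using H_periodic[of "int m + y" z] by (simp add: x add_ac)
  moreover have "T (x + y) = T (int m + y)" for y
    using turn_periodic[of "int m + y" "4 * z"] by (simp add: x algebra_simps)
  ultimately show ?thesis by blast
qed

lemma H_Suc: "H (x + 1) = H x + T x"
proof -
  obtain m where m: "\<And>y. H (x + y) = H (int m + y)" "\<And>y. T (x + y) = T (int m + y)"
    using H_shift_nat[of x] by blast
  have "H (int m + 1) = H (int m) + T (int m)"
    using H_nat[of m] H_nat[of "Suc m"] by (simp add: heading_def add.commute add.assoc)
  then show ?thesis using m(1)[of 1] m(1)[of 0] m(2)[of 0] by simp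
qed

lemma H_add_N: "H (x + N) = H x + sum_list Q"
proof -
  obtain m where m: "\<And>y. H (x + y) = H (int m + y)"
    using H_shift_nat[of x] by blast
  have "H (int m + N) = H (int m) + sum_list Q"
    using H_nat[of m] H_nat[of "m + n"] heading_add_n[of m] by simp
  then show ?thesis using m[of N] m[of 0] by simp
qed

lemma H_add_2N: "H (x + 2 * N) = H x + 2"
  using H_add_N[of x] H_add_N[of "x + N"] sum_turn by (simp add: add.assoc)

lemma turn_add_N: "T (x + N) = T x"
  by (simp add: turn_def)

definition palin :: "int \<Rightarrow> int \<Rightarrow> bool" where
  "palin k a \<longleftrightarrow> (\<forall>t. 0 \<le> t \<and> t < a \<longrightarrow> H (k + t) = H (k + a - 1 - t))"

text \<open>At even length the two middle letters would agree although the turn between them is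
  nonzero. At odd length above \<open>N = 2 * h - 1\<close> the palindrome contains the turns at
  \<open>x - h\<close> and \<open>x + h - 1\<close> around its centre \<open>x\<close>. They are
  opposite by reflection and equal by periodicity, which no turn allows.\<close>

lemma palin_length:
  assumes "palin k a" "a \<ge> 0"
  shows "a = 0 \<or> odd a \<and> a \<le> N"
proof (rule ccontr)
  assume *: "\<not> ?thesis"
  show False
  proof (cases "even a")
    case True
    then obtain c where c: "a = 2 * c" by (elim evenE)
    with * assms(2) have "c > 0" by auto
    then have "H (k + (c - 1)) = H (k + c)"
      using assms(1)[unfolded palin_def, rule_format, of "c - 1"] c by (simp add: algebra_simps)
    then show False using H_Suc[of "k + (c - 1)"] turn_neq_0[of "k + (c - 1)"] by (simp add: algebra_simps)
  next
    case False
    then obtain c where c: "a = 2 * c + 1" by (elim oddE)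
    from odd_length have "odd N" by simp
    then obtain h' where "N = 2 * h' + 1" by (elim oddE)
    then have "N = 2 * (h' + 1) - 1" by simp
    then obtain h where h: "N = 2 * h - 1" by blast
    have "h \<le> c" "h \<ge> 1" using * False c h N_pos by auto
    define x where "x = k + c"
    have refl: "H (x + t) = H (x - t)" if "\<bar>t\<bar> \<le> c" for t
    proof -
      have "0 \<le> c + t \<and> c + t < a" using that c by linarith
      then have "H (k + (c + t)) = H (k + a - 1 - (c + t))"
        using assms(1) unfolding palin_def by blast
      then show ?thesis by (simp add: x_def c algebra_simps)
    qed
    have "H (x - h) + T (x - h) = H (x - h + 1)" using H_Suc[of "x - h"] by simp
    also have "\<dots> = H (x + h - 1)" using refl[of "h - 1"] \<open>h \<le> c\<close> \<open>h \<ge> 1\<close> by (simp add: algebra_simps)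
    finally have "H (x + h - 1) = H (x - h) + T (x - h)" ..
    moreover have "H (x + h) = H (x + h - 1) + T (x + h - 1)" using H_Suc[of "x + h - 1"] by simp
    moreover have "T (x + h - 1) = T (x - h)"
      using turn_add_N[of "x - h"] h by (simp add: algebra_simps)
    moreover have "H (x + h) = H (x - h)" using refl[of h] \<open>h \<le> c\<close> \<open>h \<ge> 1\<close> by simp
    ultimately have "T (x - h) + T (x - h) = 0" by (simp add: add.assoc)
    then show False using turn_neq_uminus[of "x - h"] by (simp add: eq_neg_iff_add_eq_0)
  qed
qed

text \<open>The turns are the differences of consecutive letters. A window of length
  \<open>N\<close> from \<open>k\<close> has \<open>N - 1\<close> inner turns; the one missing from
  a period is at \<open>k - 1\<close>, the exception of the cut. Conversely, antisymmetric turns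
  make the difference \<open>D\<close> between a letter and its mirror image constant, and it
  vanishes at the middle since \<open>N\<close> is odd.\<close>

lemma palin_iff_cut: "palin k N \<longleftrightarrow> cut N T (k - 1)"
proof
  assume p: "palin k N"
  show "cut N T (k - 1)"
    unfolding cut_def
  proof (intro allI impI)
    fix y assume y: "y mod N \<noteq> (k - 1) mod N"
    have "y = k + (y - k) mod N + N * ((y - k) div N)" by simp
    moreover have "0 \<le> (y - k) mod N" "(y - k) mod N < N" using N_pos by simp_all
    ultimately obtain t z where yt: "y = k + t + N * z" and t: "0 \<le> t" "t < N" by blast
    have "t \<noteq> N - 1"
    proof
      assume "t = N - 1"
      then have "y = k - 1 + N * (z + 1)" using yt by (simp add: algebra_simps)
      then have "y mod N = (k - 1) mod N" by (metis mod_mult_self2)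
      with y show False ..
    qed
    then have t2: "t + 1 < N" using t by simp
    have "T y = T (k + t)" unfolding yt by (rule turn_periodic)
    also have "\<dots> = H (k + (t + 1)) - H (k + t)" using H_Suc[of "k + t"] by (simp add: add.assoc)
    also have "\<dots> = H (k + N - 1 - (t + 1)) - H (k + N - 1 - t)"
      using p t t2 unfolding palin_def by simp
    also have "\<dots> = - T (k + N - 2 - t)" using H_Suc[of "k + N - 2 - t"] by (simp add: algebra_simps)
    also have "T (k + N - 2 - t) = T (2 * (k - 1) - y)"
    proof -
      have "k + N - 2 - t = 2 * (k - 1) - y + N * (z + 1)"
        unfolding yt by (simp add: algebra_simps)
      then show ?thesis by (simp only: turn_periodic)
    qed
    finally show "T (2 * (k - 1) - y) = - T y" by simp
  qed
next
  assume c: "cut N T (k - 1)"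
  define D where "D t = H (k + t) - H (k + N - 1 - t)" for t
  have step: "D (t + 1) = D t" if "0 \<le> t" "t + 1 < N" for t
  proof -
    have "(k + t) mod N \<noteq> (k - 1) mod N"
    proof
      assume "(k + t) mod N = (k - 1) mod N"
      then have "N dvd (k + t) - (k - 1)" by (simp add: mod_eq_dvd_iff)
      then have "N dvd t + 1" by simp
      then show False using that zdvd_imp_le[of N "t + 1"] by simp
    qed
    then have "T (2 * (k - 1) - (k + t)) = - T (k + t)"
      by (rule c[unfolded cut_def, rule_format])
    then have "T (k + N - 2 - t) = - T (k + t)"
      using turn_add_N[of "2 * (k - 1) - (k + t)"] by (simp add: algebra_simps)
    then show ?thesis
      using H_Suc[of "k + t"] H_Suc[of "k + N - 2 - t"] by (simp add: D_def algebra_simps)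
  qed
  have const: "D (int m) = D 0" if "int m < N" for m
    using that
  proof (induction m)
    case (Suc m)
    then show ?case using step[of "int m"] by (simp add: add.commute)
  qed simp
  have "D (int (n div 2)) = 0"
  proof -
    have "N - 1 - int (n div 2) = int (n div 2)" using odd_length by (auto elim!: oddE)
    then show ?thesis by (simp add: D_def add_diff_eq[symmetric])
  qed
  then have "D 0 = 0" using const[of "n div 2"] n_pos by simp
  then have "D t = 0" if "0 \<le> t" "t < N" for t
    using const[of "nat t"] that by simp
  then show "palin k N" by (simp add: palin_def D_def)
qed

definition win :: "int \<Rightarrow> nat \<Rightarrow> word4" where
  "win k m = map (\<lambda>t. H (k + int t)) [0..<m]"

definition fac :: "int \<Rightarrow> word4 list" where
  "fac k = [win k n, win (k + N) n, win (k + 2 * N) n, win (k + 3 * N) n]"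

lemma length_win [simp]: "length (win k m) = m"
  by (simp add: win_def)

lemma nth_win [simp]: "t < m \<Longrightarrow> win k m ! t = H (k + int t)"
  by (simp add: win_def)

lemma win_add: "win k (a + b) = win k a @ win (k + int a) b"
  by (rule nth_equalityI) (auto simp: nth_append of_nat_diff algebra_simps)

lemma win_periodic: "win (k + 4 * N * z) m = win k m"
proof -
  have "H (k + 4 * N * z + int t) = H (k + int t)" for t
    using H_periodic[of "k + int t" z] by (simp add: add_ac)
  then show ?thesis by (simp add: win_def)
qed

lemma rotate_W: "rotate r W = win (int r) (4 * n)"
proof (rule nth_equalityI)
  fix t assume "t < length (rotate r W)"
  then have t: "t < 4 * n" by simp
  have "nat ((int r + int t) mod (4 * N)) = (r + t) mod (4 * n)"
    by (metis nat_int of_nat_add of_nat_mod of_nat_mult of_nat_numeral)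
  then show "rotate r W ! t = win (int r) (4 * n) ! t"
    using t by (simp add: nth_rotate H_def)
qed simp

text \<open>Letters half a period apart differ by 2, which cancels the 2 added by \<open>hat\<close>
  and leaves the plain reversal.\<close>

lemma hat_win_iff: "hat (win k a) = win (k + 2 * N) a \<longleftrightarrow> palin k (int a)"
proof -
  have "hat (win k a) ! t = H (k + int a - 1 - int t) + 2" if "t < a" for t
    using that by (simp add: hat_def rev_nth of_nat_diff algebra_simps)
  moreover have "H (k + 2 * N + int t) = H (k + int t) + 2" for t
    using H_add_2N[of "k + int t"] by (simp add: add_ac)
  ultimately have "hat (win k a) = win (k + 2 * N) a \<longleftrightarrow>
      (\<forall>t<a. H (k + int a - 1 - int t) = H (k + int t))"
    by (simp add: list_eq_iff_nth_eq hat_def)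
  also have "\<dots> \<longleftrightarrow> palin k (int a)"
    unfolding palin_def by (metis nat_int of_nat_0_le_iff of_nat_less_iff zero_le_imp_eq_int)
  finally show ?thesis .
qed

lemma palin_add_N: "palin k N \<Longrightarrow> palin (k + N) N"
proof -
  assume p: "palin k N"
  have "H (k + N + t) = H (k + N + N - 1 - t)" if "0 \<le> t" "t < N" for t
  proof -
    have "H (k + N + t) = H (k + t) + sum_list Q" using H_add_N[of "k + t"] by (simp add: add_ac)
    also have "H (k + t) = H (k + N - 1 - t)" using p that by (simp add: palin_def)
    also have "H (k + N - 1 - t) + sum_list Q = H (k + N + N - 1 - t)"
      using H_add_N[of "k + N - 1 - t"] by (simp add: algebra_simps)
    finally show ?thesis .
  qed
  then show ?thesis by (simp add: palin_def)
qed

lemma BN_square_factorizations_W: "BN_square_factorizations W = {fac k | k. palin k N}"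
proof (intro set_eqI iffI)
  fix F assume "F \<in> BN_square_factorizations W"
  then obtain A B r where F: "F = [A, B, hat A, hat B]" and r: "rotate r W = A @ B @ hat A @ hat B"
    unfolding BN_square_factorizations_def by blast
  define a b k where "a = length A" and "b = length B" and "k = int r"
  have len: "length (hat w) = length w" for w by (simp add: hat_def)
  have "length (rotate r W) = a + (b + (a + b))" by (simp add: r len a_def b_def)
  then have ab: "4 * n = a + (b + (a + b))" and ab2: "a + b = 2 * n" by simp_all
  have "A @ B @ hat A @ hat B = win k (4 * n)" using r rotate_W k_def by simp
  also have "\<dots> = win k a @ win (k + int a) b @ win (k + int (a + b)) a @ win (k + int a + int (a + b)) b"
    unfolding ab win_add by (simp add: add_ac)
  finally have A: "A = win k a" and B: "B = win (k + int a) b"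
    and A': "hat A = win (k + 2 * N) a" and B': "hat B = win (k + int a + 2 * N) b"
    by (simp_all add: a_def b_def len ab2[unfolded a_def b_def] append_eq_append_conv
        del: of_nat_add add: of_nat_add[symmetric])
  have p: "palin k (int a)" "palin (k + int a) (int b)"
    using A' B' unfolding A B hat_win_iff by simp_all
  have "a = 0 \<or> odd a \<and> a \<le> n" "b = 0 \<or> odd b \<and> b \<le> n"
    using palin_length[OF p(1)] palin_length[OF p(2)] by simp_all
  \<comment> \<open>An empty factor would force the other one to have length \<open>2 * m\<close>,
    beyond the bound; two nonempty ones must both attain it.\<close>
  moreover have "a = m \<and> b = m" if "a = 0 \<or> odd a \<and> a \<le> m" "b = 0 \<or> odd b \<and> b \<le> m"
    "a + b = 2 * m" "m > 0" for a b m :: nat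
    using that by presburger
  ultimately have "a = n" "b = n" using ab2 n_pos by blast+
  then show "F \<in> {fac k | k. palin k N}"
    using p A B A' B' F ab2 by (auto simp: fac_def algebra_simps)
next
  fix F assume "F \<in> {fac k | k. palin k N}"
  then obtain k where F: "F = fac k" and p: "palin k N" by blast
  define A B where "A = win k n" and "B = win (k + N) n"
  have A': "hat A = win (k + 2 * N) n" using p unfolding A_def hat_win_iff .
  have B': "hat B = win (k + 3 * N) n"
    using palin_add_N[OF p] hat_win_iff[of "k + N" n] by (simp add: B_def algebra_simps)
  have "k = int (nat (k mod (4 * N))) + 4 * N * (k div (4 * N))" using N_pos by simp
  then obtain r z where k: "k = int r + 4 * N * z" by blast
  have "rotate r W = win k (4 * n)" unfolding rotate_W k win_periodic ..
  also have "4 * n = n + (n + (n + n))" by simp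
  also have "win k \<dots> = A @ B @ hat A @ hat B"
    unfolding win_add A' B' by (simp add: A_def B_def algebra_simps)
  finally show "F \<in> BN_square_factorizations W"
    unfolding BN_square_factorizations_def using F A' B' by (auto simp: fac_def A_def B_def)
qed

lemma fac_periodic: "fac (k + 4 * N * z) = fac k"
proof -
  have "win (k + 4 * N * z + c) n = win (k + c) n" for c
    using win_periodic[of "k + c" z n] by (simp add: add_ac)
  from this[of 0] this[of N] this[of "2 * N"] this[of "3 * N"] show ?thesis by (simp add: fac_def)
qed

lemma rotate_fac: "rotate m (fac k) = fac (k + int m * N)"
proof (induction m)
  case (Suc m)
  have "rotate1 (fac k) = fac (k + N)" for k
    using win_periodic[of k 1 n] by (simp add: fac_def algebra_simps)
  then show ?case using Suc by (simp add: algebra_simps)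
qed simp

text \<open>Rotating the four factors by one place moves the start by \<open>N\<close>, so a class
  is a residue of starts modulo \<open>N\<close>.\<close>

lemma cyclic_shift_fac: "cyclic_shift `` {fac k} = {fac l | l. l mod N = k mod N}"
proof (intro set_eqI iffI)
  fix F assume "F \<in> cyclic_shift `` {fac k}"
  then obtain m where "F = fac (k + int m * N)"
    unfolding cyclic_shift_def by (auto simp: rotate_fac)
  moreover have "(k + int m * N) mod N = k mod N" by simp
  ultimately show "F \<in> {fac l | l. l mod N = k mod N}" by blast
next
  fix F assume "F \<in> {fac l | l. l mod N = k mod N}"
  then obtain l where F: "F = fac l" and "l mod N = k mod N" by blast
  then obtain z where "l = k + N * z" by (metis mod_eqE mod_eq_dvd_iff add.commute diff_add_cancel dvdE)
  moreover have "z = int (nat (z mod 4)) + 4 * (z div 4)" by simp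
  then obtain m y where "z = int m + 4 * y" by blast
  ultimately have "l = k + int m * N + 4 * N * y" by (simp add: algebra_simps)
  then have "F = rotate m (fac k)" unfolding F rotate_fac by (simp only: fac_periodic)
  then show "F \<in> cyclic_shift `` {fac k}" unfolding cyclic_shift_def by blast
qed

text \<open>Windows at different positions might spell the same factors. Equal factorizations still
  determine the same turns, which suffices to separate the two classes.\<close>

lemma fac_eqD:
  assumes "fac k = fac l"
  shows "T (k + t) = T (l + t)"
proof -
  have "win k (n + (n + (n + n))) = win l (n + (n + (n + n)))"
    using assms unfolding win_add by (simp add: fac_def algebra_simps)
  moreover have "n + (n + (n + n)) = 4 * n" by simp
  ultimately have "win k (4 * n) = win l (4 * n)" by simp
  then have nth: "win k (4 * n) ! t = win l (4 * n) ! t" for t by (rule arg_cong)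
  have eq: "H (k + int t) = H (l + int t)" if "t < 4 * n" for t
    unfolding nth_win[OF that, symmetric] by (rule nth)
  have "H (k + t) = H (l + t)" for t
  proof -
    have "t = int (nat (t mod (4 * N))) + 4 * N * (t div (4 * N))" using N_pos by simp
    moreover have "nat (t mod (4 * N)) < 4 * n" using N_pos by (simp add: nat_less_iff)
    ultimately obtain s z where t: "t = int s + 4 * N * z" and s: "s < 4 * n" by blast
    have "H (k + t) = H (k + int s)" "H (l + t) = H (l + int s)"
      unfolding t add.assoc[symmetric] H_periodic by simp_all
    then show ?thesis using eq[OF s] by simp
  qed
  from this[of t] this[of "t + 1"] show ?thesis
    using H_Suc[of "k + t"] H_Suc[of "l + t"] by (simp add: add.assoc)
qed

lemma cut_cong:
  assumes "j mod N = j' mod N" "cut N T j"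
  shows "cut N T j'"
proof -
  obtain z where j': "j' = j + N * z" using assms(1) by (metis mod_eqE)
  have "T (2 * j' - y) = T (2 * j - y)" for y
    using turn_periodic[of "2 * j - y" "2 * z"] by (simp add: j' algebra_simps)
  with assms show ?thesis by (simp add: cut_def)
qed

lemma cut_only:
  assumes "cut N T j" "cut N T j'" "j mod N \<noteq> j' mod N" "cut N T k"
  shows "k mod N = j mod N \<or> k mod N = j' mod N"
proof -
  \<comment> \<open>The turns 1 and 3 become 1 and -1, so that negation modulo 4 becomes negation of
    complex numbers.\<close>
  define f where "f x = (if T x = 1 then 1 else - 1 :: complex)" for x
  have T: "T x = 1 \<or> T x = 3" for x
  proof -
    have "nat (x mod N) < n" using n_pos N_pos by (simp add: nat_less_iff)
    then have "T x \<in> set Q" by (simp add: turn_def)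
    then show ?thesis using letters by auto
  qed
  have f: "cut N f l" if l: "cut N T l" for l
    unfolding cut_def
  proof (intro allI impI)
    fix y assume "y mod N \<noteq> l mod N"
    then have "T (2 * l - y) = - T y" by (rule l[unfolded cut_def, rule_format])
    then show "f (2 * l - y) = - f y" using T[of y] by (auto simp: f_def)
  qed
  have "j mod N = j' mod N \<or> j mod N = k mod N \<or> j' mod N = k mod N"
  proof (rule at_most_two_cuts)
    show "f (x mod N) = f x" for x by (simp add: f_def)
    show "f j \<noteq> 0" by (simp add: f_def)
  qed (use f assms N_pos in auto)
  with assms(3) show ?thesis by metis
qed

lemma card_BN_square_factorizations:
  assumes "cut N T j" "cut N T j'" "j mod N \<noteq> j' mod N"
  shows "card (BN_square_factorizations W // cyclic_shift) = 2"
proof -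
  define C where "C k = cyclic_shift `` {fac k}" for k
  have C: "C k = {fac l | l. l mod N = k mod N}" for k
    unfolding C_def by (rule cyclic_shift_fac)
  have residue: "(k - 1) mod N = j mod N \<longleftrightarrow> k mod N = (j + 1) mod N" for k j
    by (simp add: mod_eq_dvd_iff algebra_simps)
  have palin: "palin k N \<longleftrightarrow> k mod N = (j + 1) mod N \<or> k mod N = (j' + 1) mod N" for k
    unfolding palin_iff_cut residue[symmetric] using cut_only[OF assms] cut_cong assms(1,2) by metis
  have "BN_square_factorizations W // cyclic_shift = {C k | k. palin k N}"
    by (auto simp: quotient_def BN_square_factorizations_W C_def)
  also have "\<dots> = {C (j + 1), C (j' + 1)}"
    unfolding palin by (auto simp: C)
  finally have "BN_square_factorizations W // cyclic_shift = {C (j + 1), C (j' + 1)}" .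
  moreover have "C (j + 1) \<noteq> C (j' + 1)"
  proof
    assume "C (j + 1) = C (j' + 1)"
    then have "fac (j + 1) \<in> C (j' + 1)" unfolding C by blast
    then obtain l where l: "fac (j + 1) = fac l" "l mod N = (j' + 1) mod N" unfolding C by blast
    \<comment> \<open>Equal classes would make \<open>e\<close> a period of the turn word moving
      \<open>j\<close> to another residue. The cut at \<open>j\<close> then gives
      \<open>T j = - T j\<close>.\<close>
    define e where "e = l - 1 - j"
    have shift: "T (y + e) = T y" for y
      using fac_eqD[OF l(1), of "y - j - 1"] by (simp add: e_def algebra_simps)
    have "(j + e) mod N \<noteq> j mod N"
      using l(2) assms(3) residue[of l j'] by (simp add: e_def)
    then have "T (2 * j - (j + e)) = - T (j + e)"
      by (rule assms(1)[unfolded cut_def, rule_format])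
    moreover have "T (2 * j - (j + e)) = T j" using shift[of "j - e"] by simp
    ultimately show False using shift[of j] turn_neq_uminus[of j] by simp
  qed
  ultimately show ?thesis by simp
qed

end

section \<open>Application to the snowflakes\<close>

lemma quarter_centered:
  assumes "i > 0" "n \<ge> 1"
  obtains u v where "quarter i n = u @ bar v" "centered u v"
proof (rule quarter_refine[OF assms])
  fix j k u v
  assume "j \<ge> 1" "(refine ^^ k) (zigzag j, [1]) = (u, v)" "quarter i n = u @ bar v"
  then show thesis using that centered_refine_funpow[OF centered_even] by blast
next
  fix j u v assume "(refine ^^ n) ([1], zigzag j) = (u, v)" "quarter i n = u @ bar v"
  then show thesis using that centered_odd assms(2) by blast
qed

text \<open>Without its last letter the word is sent to itself by reversal followed by
  \<open>bar\<close>. If that part had odd length, its middle letter would equal its own negative,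
  which is false for 1 and 3.\<close>

lemma length_centered:
  assumes "centered u v" "set (u @ bar v) \<subseteq> {1, 3}"
  shows "odd (length (u @ bar v))" "0 < length u" "length u < length (u @ bar v)"
proof -
  obtain x y s where u: "u = x @ [s]" and v: "v = y @ [- s]" and pal: "rev x = x" "rev y = y"
    and sym: "x @ s # bar y = y @ - s # bar x"
    using assms(1) unfolding centered_def by blast
  define X where "X = x @ s # bar y"
  have Q: "u @ bar v = X @ [s]" by (simp add: u v X_def)
  have anti: "bar (rev X) = X"
    using sym pal by (simp add: X_def bar_rev[symmetric])
  have "even (length X)"
  proof (rule ccontr)
    assume "odd (length X)"
    then obtain m where m: "length X = 2 * m + 1" by (elim oddE)
    then have "X ! m = bar (rev X) ! m" using anti by simp
    also have "\<dots> = - X ! m" using m by (simp add: bar_eq rev_nth)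
    finally have "X ! m = - X ! m" .
    moreover have "X ! m \<in> set X" using m by simp
    then have "X ! m \<in> {1, 3}" using assms(2) Q by auto
    ultimately show False by auto
  qed
  then show "odd (length (u @ bar v))" unfolding Q by simp
  show "0 < length u" "length u < length (u @ bar v)" by (simp_all add: u v)
qed

theorem theorem2:
  fixes i n :: nat
  assumes "i > 0" and "n \<ge> 1"
  shows "(\<forall>\<alpha>. \<exists>P. snowflake i n P (snowflake_word \<alpha> i n)) \<and>
         (\<forall>P w. snowflake i n P w \<longrightarrow> double_square P w)"
proof (intro conjI allI impI)
  obtain u v where uv: "quarter i n = u @ bar v" "centered u v"
    using quarter_centered[OF assms] by blast
  note len = length_centered[OF uv(2), folded uv(1), OF set_quarter[OF assms]]
  fix \<alpha>
  have path: "closed_path (snowflake_word \<alpha> i n)" "non_crossing (snowflake_word \<alpha> i n)"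
    using snowflake_word_path[OF assms] by simp_all
  moreover have "snowflake_word \<alpha> i n \<noteq> []"
    using len by (auto simp: snowflake_word_eq concat_replicate_4 simp flip: length_greater_0_conv)
  moreover from path(2) have "inj_on (edge 0 (snowflake_word \<alpha> i n)) {..<length (snowflake_word \<alpha> i n)}"
    unfolding non_crossing_def ..
  ultimately obtain P where "finite P" "P \<noteq> {}"
      "boundary_edges P = edge 0 (snowflake_word \<alpha> i n) ` {..<length (snowflake_word \<alpha> i n)}"
    using closed_path_bounds_region[of "snowflake_word \<alpha> i n"] by auto
  then have "polyomino P (snowflake_word \<alpha> i n)"
    unfolding polyomino_def using path by blast
  then show "\<exists>P. snowflake i n P (snowflake_word \<alpha> i n)"
    unfolding snowflake_def by blast
next
  obtain u v where uv: "quarter i n = u @ bar v" "centered u v"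
    using quarter_centered[OF assms] by blast
  note len = length_centered[OF uv(2), folded uv(1), OF set_quarter[OF assms]]
  fix P w assume "snowflake i n P w"
  then obtain \<alpha> where P: "polyomino P w" and w: "w = snowflake_word \<alpha> i n"
    unfolding snowflake_def by blast
  interpret turning_word "quarter i n" \<alpha>
    by unfold_locales (use set_quarter[OF assms] len in auto)
  have "w = W" by (simp add: w snowflake_word_eq W_def)
  moreover have "- 1 mod N \<noteq> (int (length u) - 1) mod N"
  proof
    assume "- 1 mod N = (int (length u) - 1) mod N"
    then have "N dvd int (length u)" by (simp add: mod_eq_dvd_iff)
    then have "N \<le> int (length u)" using len(2) by (intro zdvd_imp_le) auto
    with len(3) show False by simp
  qed
  ultimately have "card (BN_square_factorizations w // cyclic_shift) = 2"
    using card_BN_square_factorizations cuts_centered[OF uv(2), folded uv(1)] by simp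
  with P show "double_square P w" unfolding double_square_def by blast
qed

end
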